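(* Let $R$ be a subdirectly irreducible $*$-regular ring (with or without unit), and let $J$ be its minimal ideal. Then $R$ is a homomorphic image of a $*$-regular $*$-subring of an ultraproduct of $*$-rings $eRe$, where $e$ is a nonzero projection in $J$; that is, there are a family $(e_i)_{i\in I}$ of nonzero projections $e_i\in J$, an ultrafilter $\mathcal{U}$ on $I$, a $*$-regular $*$-subring $S$ of the ultraproduct $\prod_{i\in I} e_iRe_i/\mathcal{U}$, and a surjective homomorphism of $*$-rings $S\to R$. In particular, any variety of $*$-regular rings (with or without unit) is generated by its simple members.
   Context: Rings are associative. A $*$-ring is a ring $R$ equipped with an involution $a\mapsto a^*$, i.e. $(a+b)^*=a^*+b^*$, $(ab)^*=b^*a^*$, $(a^* )^*=a$. The result is meant in two versions: for $*$-rings without unit in the signature (operations $+,-,\cdot,0,*$), and for $*$-rings with unit, in which case the constant $1$ is part of the signature, so that $*$-subrings contain the unit and homomorphisms preserve it. An element $e\in R$ is a projection if $e=e^2=e^*$. $R$ is proper if $aa^*=0$ implies $a=0$. A $*$-regular ring is a proper $*$-ring $R$ that is von Neumann regular (for each $a\in R$ there is $x\in R$ with $axa=a$). For a projection $e$ of a $*$-regular ring $R$, $eRe$ is a $*$-regular ring with unit $e$ under the operations inherited from $R$; in the version with unit, $eRe$ is regarded as a $*$-ring with unit constant $e$. In a $*$-regular ring every $a$ has a unique pseudo-inverse $a^+$ satisfying $a=aa^+a$, $a^+=a^+aa^+$, $(aa^+)^*=aa^+$, $(a^+a)^*=a^+a$; a $*$-subring of a $*$-regular ring is $*$-regular if and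 only if it is closed under $a\mapsto a^+$. With the operation $a\mapsto a^+$ included into the signature, $*$-regular rings form a variety (equational class), and "variety of $*$-regular rings" means a subvariety in this signature. All ideals of a $*$-regular ring are closed under $*$, and congruences correspond to two-sided ideals; $R$ is subdirectly irreducible if and only if it has a unique minimal ideal $J$, i.e. a nonzero two-sided ideal contained in every nonzero two-sided ideal. $R$ is simple if it is nonzero and its only two-sided ideals are $0$ and $R$. *)

theory Defs
  imports "HOL-Algebra.RingHom"
begin

text \<open>
  The parameter \<open>u\<close> selects the signature: \<open>+, -, \<cdot>, 0, *\<close> for \<open>u = False\<close>, and the same
  together with the constant \<open>1\<close> for \<open>u = True\<close>.  For \<open>u = False\<close> the field \<open>one\<close> of the
  record is junk: no definition below reads it.  The locales \<^locale>\<open>ring\<close> and \<^locale>\<open>ideal\<close>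
  always assume a unit, so they cannot be used directly; the lemmas below show that for
  \<open>u = True\<close> our notions specialise to the library's.
\<close>

record 'a star_ring = "'a ring" +
  star :: "'a \<Rightarrow> 'a"

locale star_ring = abelian_group R for u :: bool and R :: "('a, 'm) star_ring_scheme" (structure) +
  assumes mult_closed: "\<lbrakk>a \<in> carrier R; b \<in> carrier R\<rbrakk> \<Longrightarrow> a \<otimes> b \<in> carrier R"
    and mult_assoc: "\<lbrakk>a \<in> carrier R; b \<in> carrier R; c \<in> carrier R\<rbrakk>
      \<Longrightarrow> (a \<otimes> b) \<otimes> c = a \<otimes> (b \<otimes> c)"
    and distrib_right: "\<lbrakk>a \<in> carrier R; b \<in> carrier R; c \<in> carrier R\<rbrakk>
      \<Longrightarrow> (a \<oplus> b) \<otimes> c = a \<otimes> c \<oplus> b \<otimes> c"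
    and distrib_left: "\<lbrakk>a \<in> carrier R; b \<in> carrier R; c \<in> carrier R\<rbrakk>
      \<Longrightarrow> c \<otimes> (a \<oplus> b) = c \<otimes> a \<oplus> c \<otimes> b"
    and unit_closed: "u \<Longrightarrow> \<one> \<in> carrier R"
    and unit_left: "\<lbrakk>u; a \<in> carrier R\<rbrakk> \<Longrightarrow> \<one> \<otimes> a = a"
    and unit_right: "\<lbrakk>u; a \<in> carrier R\<rbrakk> \<Longrightarrow> a \<otimes> \<one> = a"
    and star_closed: "a \<in> carrier R \<Longrightarrow> star R a \<in> carrier R"
    and star_add: "\<lbrakk>a \<in> carrier R; b \<in> carrier R\<rbrakk> \<Longrightarrow> star R (a \<oplus> b) = star R a \<oplus> star R b"
    and star_mult: "\<lbrakk>a \<in> carrier R; b \<in> carrier R\<rbrakk> \<Longrightarrow> star R (a \<otimes> b) = star R b \<otimes> star R a"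
    and star_star: "a \<in> carrier R \<Longrightarrow> star R (star R a) = a"

definition is_projection :: "('a, 'm) star_ring_scheme \<Rightarrow> 'a \<Rightarrow> bool" where
  "is_projection R e \<longleftrightarrow> e \<in> carrier R \<and> e = e \<otimes>\<^bsub>R\<^esub> e \<and> e = star R e"

definition proper :: "('a, 'm) star_ring_scheme \<Rightarrow> bool" where
  "proper R \<longleftrightarrow> (\<forall>a \<in> carrier R. a \<otimes>\<^bsub>R\<^esub> star R a = \<zero>\<^bsub>R\<^esub> \<longrightarrow> a = \<zero>\<^bsub>R\<^esub>)"

definition von_neumann_regular :: "('a, 'm) ring_scheme \<Rightarrow> bool" where
  "von_neumann_regular R \<longleftrightarrow>
     (\<forall>a \<in> carrier R. \<exists>x \<in> carrier R. a \<otimes>\<^bsub>R\<^esub> x \<otimes>\<^bsub>R\<^esub> a = a)"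

definition star_regular :: "bool \<Rightarrow> ('a, 'm) star_ring_scheme \<Rightarrow> bool" where
  "star_regular u R \<longleftrightarrow> star_ring u R \<and> proper R \<and> von_neumann_regular R"

definition is_pseudo_inverse :: "('a, 'm) star_ring_scheme \<Rightarrow> 'a \<Rightarrow> 'a \<Rightarrow> bool" where
  "is_pseudo_inverse R a x \<longleftrightarrow> x \<in> carrier R \<and>
     a = a \<otimes>\<^bsub>R\<^esub> x \<otimes>\<^bsub>R\<^esub> a \<and> x = x \<otimes>\<^bsub>R\<^esub> a \<otimes>\<^bsub>R\<^esub> x \<and>
     star R (a \<otimes>\<^bsub>R\<^esub> x) = a \<otimes>\<^bsub>R\<^esub> x \<and> star R (x \<otimes>\<^bsub>R\<^esub> a) = x \<otimes>\<^bsub>R\<^esub> a"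

definition pseudo_inverse :: "('a, 'm) star_ring_scheme \<Rightarrow> 'a \<Rightarrow> 'a" where
  "pseudo_inverse R a = (THE x. is_pseudo_inverse R a x)"

definition star_subring :: "bool \<Rightarrow> 'a set \<Rightarrow> ('a, 'm) star_ring_scheme \<Rightarrow> bool" where
  "star_subring u S R \<longleftrightarrow> additive_subgroup S R \<and>
     (\<forall>a \<in> S. \<forall>b \<in> S. a \<otimes>\<^bsub>R\<^esub> b \<in> S) \<and> (\<forall>a \<in> S. star R a \<in> S) \<and> (u \<longrightarrow> \<one>\<^bsub>R\<^esub> \<in> S)"

definition star_ring_hom ::
  "bool \<Rightarrow> ('a, 'm) star_ring_scheme \<Rightarrow> ('b, 'n) star_ring_scheme \<Rightarrow> ('a \<Rightarrow> 'b) set" where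
  "star_ring_hom u R S = {h \<in> hom R S \<inter> hom (add_monoid R) (add_monoid S).
     (\<forall>a \<in> carrier R. h (star R a) = star S (h a)) \<and> (u \<longrightarrow> h \<one>\<^bsub>R\<^esub> = \<one>\<^bsub>S\<^esub>)}"

definition two_sided_ideal :: "'a set \<Rightarrow> ('a, 'm) ring_scheme \<Rightarrow> bool" where
  "two_sided_ideal J R \<longleftrightarrow> additive_subgroup J R \<and>
     (\<forall>a \<in> J. \<forall>x \<in> carrier R. x \<otimes>\<^bsub>R\<^esub> a \<in> J \<and> a \<otimes>\<^bsub>R\<^esub> x \<in> J)"

lemma ring_if_star_ring: "star_ring True R \<Longrightarrow> ring R"
  by (auto simp: star_ring_def star_ring_axioms_def ring_def ring_axioms_def
      intro!: monoid.intro)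

lemma two_sided_ideal_iff_ideal: "ring R \<Longrightarrow> two_sided_ideal J R \<longleftrightarrow> ideal J R"
  by (auto simp: two_sided_ideal_def ideal_def ideal_axioms_def)

lemma star_ring_hom_True_iff:
  "h \<in> star_ring_hom True R S \<longleftrightarrow>
     h \<in> ring_hom R S \<and> (\<forall>a \<in> carrier R. h (star R a) = star S (h a))"
  by (auto simp: star_ring_hom_def ring_hom_def hom_def)

definition minimal_ideal :: "('a, 'm) ring_scheme \<Rightarrow> 'a set \<Rightarrow> bool" where
  "minimal_ideal R J \<longleftrightarrow> two_sided_ideal J R \<and> J \<noteq> {\<zero>\<^bsub>R\<^esub>} \<and>
     (\<forall>K. two_sided_ideal K R \<and> K \<noteq> {\<zero>\<^bsub>R\<^esub>} \<longrightarrow> J \<subseteq> K)"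

text \<open>
  Congruences of a \<open>*\<close>-regular ring correspond to its two-sided ideals, so subdirect
  irreducibility means that there is a least nonzero ideal.
\<close>

definition subdirectly_irreducible :: "('a, 'm) ring_scheme \<Rightarrow> bool" where
  "subdirectly_irreducible R \<longleftrightarrow> (\<exists>J. minimal_ideal R J)"

definition is_simple :: "('a, 'm) ring_scheme \<Rightarrow> bool" where
  "is_simple R \<longleftrightarrow> carrier R \<noteq> {\<zero>\<^bsub>R\<^esub>} \<and>
     (\<forall>K. two_sided_ideal K R \<longrightarrow> K = {\<zero>\<^bsub>R\<^esub>} \<or> K = carrier R)"

definition corner :: "('a, 'm) star_ring_scheme \<Rightarrow> 'a \<Rightarrow> ('a, 'm) star_ring_scheme" where
  "corner R e = R\<lparr>carrier := {e \<otimes>\<^bsub>R\<^esub> x \<otimes>\<^bsub>R\<^esub> e | x. x \<in> carrier R}, one := e\<rparr>"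

text \<open>
  An ultrafilter on a set \<open>I\<close> is rendered as a filter on the ambient type that contains \<open>I\<close>.
\<close>

definition ultrafilter_on :: "'i set \<Rightarrow> 'i filter \<Rightarrow> bool" where
  "ultrafilter_on I U \<longleftrightarrow> U \<noteq> bot \<and> (\<forall>\<^sub>F i in U. i \<in> I) \<and>
     (\<forall>P. (\<forall>\<^sub>F i in U. P i) \<or> (\<forall>\<^sub>F i in U. \<not> P i))"

definition ultra_rel ::
  "'i set \<Rightarrow> ('i \<Rightarrow> ('a, 'm) star_ring_scheme) \<Rightarrow> 'i filter \<Rightarrow> (('i \<Rightarrow> 'a) \<times> ('i \<Rightarrow> 'a)) set" where
  "ultra_rel I A U = {(f, g). f \<in> (\<Pi>\<^sub>E i\<in>I. carrier (A i)) \<and> g \<in> (\<Pi>\<^sub>E i\<in>I. carrier (A i)) \<and>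
     (\<forall>\<^sub>F i in U. f i = g i)}"

definition ultra_class ::
  "'i set \<Rightarrow> ('i \<Rightarrow> ('a, 'm) star_ring_scheme) \<Rightarrow> 'i filter \<Rightarrow> ('i \<Rightarrow> 'a) \<Rightarrow> ('i \<Rightarrow> 'a) set" where
  "ultra_class I A U f = ultra_rel I A U `` {restrict f I}"

definition ultraproduct ::
  "'i set \<Rightarrow> ('i \<Rightarrow> ('a, 'm) star_ring_scheme) \<Rightarrow> 'i filter \<Rightarrow> ('i \<Rightarrow> 'a) set star_ring" where
  "ultraproduct I A U = \<lparr>
     carrier = (\<Pi>\<^sub>E i\<in>I. carrier (A i)) // ultra_rel I A U,
     monoid.mult = (\<lambda>F G. \<Union>f\<in>F. \<Union>g\<in>G. ultra_class I A U (\<lambda>i. f i \<otimes>\<^bsub>A i\<^esub> g i)),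
     one = ultra_class I A U (\<lambda>i. \<one>\<^bsub>A i\<^esub>),
     ring.zero = ultra_class I A U (\<lambda>i. \<zero>\<^bsub>A i\<^esub>),
     ring.add = (\<lambda>F G. \<Union>f\<in>F. \<Union>g\<in>G. ultra_class I A U (\<lambda>i. f i \<oplus>\<^bsub>A i\<^esub> g i)),
     star = (\<lambda>F. \<Union>f\<in>F. ultra_class I A U (\<lambda>i. star (A i) (f i)))\<rparr>"

text \<open>
  Terms in the signature of \<open>*\<close>-regular rings, which includes the pseudo-inverse; the
  constant \<open>1\<close> is admitted only for \<open>u = True\<close>.
\<close>

datatype star_term =
    Var nat | Zero | One | Neg star_term | Add star_term star_term | Mul star_term star_term
  | Star star_term | PInv star_term

primrec in_signature :: "bool \<Rightarrow> star_term \<Rightarrow> bool" where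
  "in_signature u (Var n) \<longleftrightarrow> True"
| "in_signature u Zero \<longleftrightarrow> True"
| "in_signature u One \<longleftrightarrow> u"
| "in_signature u (Neg s) \<longleftrightarrow> in_signature u s"
| "in_signature u (Add s t) \<longleftrightarrow> in_signature u s \<and> in_signature u t"
| "in_signature u (Mul s t) \<longleftrightarrow> in_signature u s \<and> in_signature u t"
| "in_signature u (Star s) \<longleftrightarrow> in_signature u s"
| "in_signature u (PInv s) \<longleftrightarrow> in_signature u s"

primrec interp :: "('a, 'm) star_ring_scheme \<Rightarrow> (nat \<Rightarrow> 'a) \<Rightarrow> star_term \<Rightarrow> 'a" where
  "interp R v (Var n) = v n"
| "interp R v Zero = \<zero>\<^bsub>R\<^esub>"
| "interp R v One = \<one>\<^bsub>R\<^esub>"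
| "interp R v (Neg s) = \<ominus>\<^bsub>R\<^esub> interp R v s"
| "interp R v (Add s t) = interp R v s \<oplus>\<^bsub>R\<^esub> interp R v t"
| "interp R v (Mul s t) = interp R v s \<otimes>\<^bsub>R\<^esub> interp R v t"
| "interp R v (Star s) = star R (interp R v s)"
| "interp R v (PInv s) = pseudo_inverse R (interp R v s)"

definition satisfies :: "('a, 'm) star_ring_scheme \<Rightarrow> star_term \<Rightarrow> star_term \<Rightarrow> bool" where
  "satisfies R s t \<longleftrightarrow>
     (\<forall>v. (\<forall>n. v n \<in> carrier R) \<longrightarrow> interp R v s = interp R v t)"

text \<open>
  A class of rings is represented by its members whose carrier is a set of elements of the
  type \<open>'a\<close>, so varieties are equational classes relative to this universe, and the
  generated variety is the smallest such class containing \<open>K\<close>.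
\<close>

definition variety :: "bool \<Rightarrow> 'a star_ring set \<Rightarrow> bool" where
  "variety u V \<longleftrightarrow> (\<exists>E. (\<forall>(s, t) \<in> E. in_signature u s \<and> in_signature u t) \<and>
     V = {R. star_regular u R \<and> (\<forall>(s, t) \<in> E. satisfies R s t)})"

definition generated_variety :: "bool \<Rightarrow> 'a star_ring set \<Rightarrow> 'a star_ring set" where
  "generated_variety u K = \<Inter>{W. variety u W \<and> K \<subseteq> W}"

end

theory Submission
  imports Defs
begin

text \<open>
  Let \<open>R\<close> be subdirectly irreducible with minimal ideal \<open>J\<close>.  Two facts make \<open>R\<close> recoverable
  from its corners \<open>eRe\<close> at the nonzero projections \<open>e\<close> of \<open>J\<close>.  The projections in \<open>J\<close> are
  directed, and every \<open>x\<close> in \<open>J\<close> satisfies \<open>ex = x\<close> for all sufficiently large \<open>e\<close>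
  (\<open>J_directed\<close>); and \<open>R\<close> acts faithfully on \<open>J\<close> by left multiplication (\<open>J_faithful\<close>).  Call a
  family \<open>a\<^sub>e\<close> convergent to \<open>r\<close> if for each \<open>x\<close> in \<open>J\<close> eventually \<open>a\<^sub>ex = rx\<close> and
  \<open>a\<^sub>e\<^sup>*x = r\<^sup>*x\<close>.  Limits are unique by faithfulness, each \<open>r\<close> is the limit of its compressions
  \<open>ere\<close>, and the unit is the limit of the units \<open>e\<close> of the corners.  Convergence is visibly
  compatible with the ring operations and the involution.

  The heart of the matter is that it is compatible with pseudo-inverses too
  (\<open>pseudo_inverse_local\<close>): to have \<open>a\<^sup>+x = r\<^sup>+x\<close> it suffices that \<open>a\<close> agrees with \<open>r\<close>, and \<open>a\<^sup>*\<close>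
  with \<open>r\<^sup>*\<close>, on finitely many elements of the left ideal generated by \<open>x\<close>.  Hence the
  convergent families form a \<open>*\<close>-regular \<open>*\<close>-subring of the product of the corners.  For an
  ultrafilter containing all the sets \<open>{e. ex = x}\<close>, their classes form a \<open>*\<close>-regular
  \<open>*\<close>-subring of the ultraproduct, and taking limits maps it onto \<open>R\<close>.

  For the statement on varieties, suppose that an identity fails in a member of \<open>V\<close>, with
  \<open>d \<noteq> 0\<close> the difference of the values of its two sides.  The quotient \<open>Q\<close> by an ideal maximal
  among those avoiding \<open>d\<close> is subdirectly irreducible and the identity still fails there.  The
  corners of \<open>Q\<close> at nonzero projections of its minimal ideal are simple (\<open>corner_simple\<close>).  They
  belong to \<open>V\<close>: the corner \<open>eQe\<close> is the image of the commutant of \<open>e\<close> in \<open>Q\<close> under \<open>x \<mapsto> ex\<close>,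
  which respects units as well.  If the identity held in all simple members of \<open>V\<close>, it would
  hold in all these corners.  But convergence is compatible with all operations of the signature,
  so the value of a term in \<open>Q\<close> is the limit of its values in the corners, and the identity would
  hold in \<open>Q\<close>.
\<close>

section \<open>Rings with involution\<close>

lemma star_ringI:
  fixes R (structure)
  assumes "abelian_group R"
    and "\<And>a b. \<lbrakk>a \<in> carrier R; b \<in> carrier R\<rbrakk> \<Longrightarrow> a \<otimes> b \<in> carrier R"
    and "\<And>a b c. \<lbrakk>a \<in> carrier R; b \<in> carrier R; c \<in> carrier R\<rbrakk>
      \<Longrightarrow> (a \<otimes> b) \<otimes> c = a \<otimes> (b \<otimes> c)"
    and "\<And>a b c. \<lbrakk>a \<in> carrier R; b \<in> carrier R; c \<in> carrier R\<rbrakk>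
      \<Longrightarrow> (a \<oplus> b) \<otimes> c = a \<otimes> c \<oplus> b \<otimes> c"
    and "\<And>a b c. \<lbrakk>a \<in> carrier R; b \<in> carrier R; c \<in> carrier R\<rbrakk>
      \<Longrightarrow> c \<otimes> (a \<oplus> b) = c \<otimes> a \<oplus> c \<otimes> b"
    and "u \<Longrightarrow> \<one> \<in> carrier R"
    and "\<And>a. \<lbrakk>u; a \<in> carrier R\<rbrakk> \<Longrightarrow> \<one> \<otimes> a = a"
    and "\<And>a. \<lbrakk>u; a \<in> carrier R\<rbrakk> \<Longrightarrow> a \<otimes> \<one> = a"
    and "\<And>a. a \<in> carrier R \<Longrightarrow> star R a \<in> carrier R"
    and "\<And>a b. \<lbrakk>a \<in> carrier R; b \<in> carrier R\<rbrakk> \<Longrightarrow> star R (a \<oplus> b) = star R a \<oplus> star R b"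
    and "\<And>a b. \<lbrakk>a \<in> carrier R; b \<in> carrier R\<rbrakk> \<Longrightarrow> star R (a \<otimes> b) = star R b \<otimes> star R a"
    and "\<And>a. a \<in> carrier R \<Longrightarrow> star R (star R a) = a"
  shows "star_ring u R"
  using assms by (intro star_ring.intro star_ring_axioms.intro) auto

lemma (in abelian_group) additive_subgroup_iff:
  "additive_subgroup S G \<longleftrightarrow> S \<subseteq> carrier G \<and> \<zero> \<in> S \<and>
     (\<forall>x\<in>S. \<forall>y\<in>S. x \<oplus> y \<in> S) \<and> (\<forall>x\<in>S. \<ominus> x \<in> S)"
proof
  assume "additive_subgroup S G"
  then interpret additive_subgroup S G .
  show "S \<subseteq> carrier G \<and> \<zero> \<in> S \<and> (\<forall>x\<in>S. \<forall>y\<in>S. x \<oplus> y \<in> S) \<and> (\<forall>x\<in>S. \<ominus> x \<in> S)"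
    using a_subset by auto
next
  assume "S \<subseteq> carrier G \<and> \<zero> \<in> S \<and> (\<forall>x\<in>S. \<forall>y\<in>S. x \<oplus> y \<in> S) \<and> (\<forall>x\<in>S. \<ominus> x \<in> S)"
  then show "additive_subgroup S G"
    by (intro additive_subgroupI subgroup.intro) (auto simp: a_inv_def)
qed

context star_ring
begin

lemmas closed_simps = mult_closed star_closed unit_closed

lemma zero_mult: "a \<in> carrier R \<Longrightarrow> \<zero> \<otimes> a = \<zero>"
  using distrib_right[of \<zero> \<zero> a] mult_closed[of \<zero> a] add.r_cancel_one[of "\<zero> \<otimes> a" "\<zero> \<otimes> a"]
  by simp

lemma mult_zero: "a \<in> carrier R \<Longrightarrow> a \<otimes> \<zero> = \<zero>"
  using distrib_left[of \<zero> \<zero> a] mult_closed[of a \<zero>] add.r_cancel_one[of "a \<otimes> \<zero>" "a \<otimes> \<zero>"]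
  by simp

lemma minus_mult: "\<lbrakk>a \<in> carrier R; b \<in> carrier R\<rbrakk> \<Longrightarrow> (\<ominus> a) \<otimes> b = \<ominus> (a \<otimes> b)"
  by (rule minus_equality[symmetric])
    (auto simp: distrib_right[symmetric] l_neg zero_mult mult_closed)

lemma mult_minus: "\<lbrakk>a \<in> carrier R; b \<in> carrier R\<rbrakk> \<Longrightarrow> a \<otimes> (\<ominus> b) = \<ominus> (a \<otimes> b)"
  by (rule minus_equality[symmetric])
    (auto simp: distrib_left[symmetric] l_neg mult_zero mult_closed)

lemma star_zero: "star R \<zero> = \<zero>"
  using star_add[of \<zero> \<zero>] star_closed[of \<zero>] add.r_cancel_one[of "star R \<zero>" "star R \<zero>"]
  by simp

lemma star_minus: "a \<in> carrier R \<Longrightarrow> star R (\<ominus> a) = \<ominus> (star R a)"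
  by (rule minus_equality[symmetric])
    (auto simp: star_add[symmetric] l_neg star_zero star_closed)

lemma minus_zero_iff: "\<lbrakk>a \<in> carrier R; b \<in> carrier R\<rbrakk> \<Longrightarrow> a \<ominus> b = \<zero> \<longleftrightarrow> a = b"
  by (metis a_minus_def a_inv_closed minus_equality minus_minus r_neg)

lemma diff_mult: "\<lbrakk>a \<in> carrier R; b \<in> carrier R; c \<in> carrier R\<rbrakk>
    \<Longrightarrow> (a \<ominus> b) \<otimes> c = a \<otimes> c \<ominus> b \<otimes> c"
  by (simp add: a_minus_def distrib_right minus_mult)

lemma mult_diff: "\<lbrakk>a \<in> carrier R; b \<in> carrier R; c \<in> carrier R\<rbrakk>
    \<Longrightarrow> c \<otimes> (a \<ominus> b) = c \<otimes> a \<ominus> c \<otimes> b"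
  by (simp add: a_minus_def distrib_left mult_minus)

end

section \<open>Pseudo-inverses\<close>

locale star_regular_ring = star_ring +
  assumes proper: "proper R"
    and regular: "von_neumann_regular R"

lemma star_regular_iff: "star_regular u R \<longleftrightarrow> star_regular_ring u R"
  by (simp add: star_regular_def star_regular_ring_def star_regular_ring_axioms_def)

context star_regular_ring
begin

lemma star_self_cancel:
  assumes "a \<in> carrier R" "star R a \<otimes> a = \<zero>"
  shows "a = \<zero>"
proof -
  have "star R a = \<zero>"
    using proper assms by (auto simp: proper_def star_closed star_star)
  then show ?thesis
    using star_star[OF assms(1)] star_zero by simp
qed

text \<open>By properness \<open>star a \<otimes> a \<otimes> x = star a \<otimes> a \<otimes> y\<close> forces \<open>a \<otimes> x = a \<otimes> y\<close>.  A weak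
  inverse \<open>y\<close> of \<open>star a \<otimes> a\<close> therefore gives a self-adjoint \<open>a \<otimes> y \<otimes> star a\<close> that is a left
  unit for \<open>a\<close>: the projection onto the right ideal generated by \<open>a\<close>.\<close>

lemma range_projection:
  assumes a: "a \<in> carrier R"
  shows "\<exists>y\<in>carrier R. a \<otimes> y \<otimes> star R a \<otimes> a = a \<and> star R (a \<otimes> y \<otimes> star R a) = a \<otimes> y \<otimes> star R a"
proof -
  let ?b = "star R a \<otimes> a"
  have b: "?b \<in> carrier R" and sa: "star R a \<in> carrier R"
    using a by (auto simp: closed_simps)
  obtain y where y: "y \<in> carrier R" "?b \<otimes> y \<otimes> ?b = ?b"
    using regular b by (auto simp: von_neumann_regular_def)
  define c where "c = a \<otimes> (y \<otimes> ?b)"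
  have c: "c \<in> carrier R" using a b y by (simp add: c_def closed_simps)
  have 1: "star R a \<otimes> c = star R a \<otimes> a"
    using y a b sa by (simp add: c_def mult_assoc closed_simps)
  have "star R (c \<ominus> a) \<otimes> (c \<ominus> a) = \<zero>"
  proof -
    have "star R a \<otimes> (c \<ominus> a) = \<zero>"
      using 1 a c sa by (simp add: mult_diff minus_zero_iff mult_closed)
    moreover have "star R c \<otimes> x = star R (y \<otimes> ?b) \<otimes> (star R a \<otimes> x)" if "x \<in> carrier R" for x
      using that a y b sa by (simp add: c_def star_mult mult_assoc closed_simps)
    ultimately show ?thesis
      using a b c y by (simp add: a_minus_def star_add star_minus distrib_right minus_mult
          closed_simps mult_zero)
  qed
  then have "c = a" using star_self_cancel[of "c \<ominus> a"] a c minus_zero_iff by simp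
  then have p: "a \<otimes> y \<otimes> star R a \<otimes> a = a" using a y b sa by (simp add: c_def mult_assoc closed_simps)
  define q where "q = a \<otimes> y \<otimes> star R a"
  have q: "q \<in> carrier R" "q \<otimes> a = a" using a y sa p by (simp_all add: q_def closed_simps)
  have "q \<otimes> star R q = star R q"
    using q a y sa by (simp add: q_def star_mult star_star closed_simps mult_assoc)
      (metis mult_assoc mult_closed star_closed)
  then have "star R q = q"
    using q by (metis star_mult star_closed star_star)
  then show ?thesis using y p q_def by blast
qed

text \<open>With \<open>p\<close> and \<open>q\<close> the projections onto the right ideal and the left ideal generated by \<open>a\<close>,
  any weak inverse \<open>x\<close> of \<open>a\<close> can be corrected to the pseudo-inverse \<open>q \<otimes> x \<otimes> p\<close>.\<close>

lemma pseudo_inverse_exists: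
  assumes a: "a \<in> carrier R"
  shows "\<exists>x. is_pseudo_inverse R a x"
proof -
  have sa: "star R a \<in> carrier R" using a by (simp add: star_closed)
  obtain y where y: "y \<in> carrier R" "a \<otimes> y \<otimes> star R a \<otimes> a = a"
     "star R (a \<otimes> y \<otimes> star R a) = a \<otimes> y \<otimes> star R a"
    using range_projection[OF a] by blast
  obtain z where z: "z \<in> carrier R" "star R a \<otimes> z \<otimes> a \<otimes> star R a = star R a"
     "star R (star R a \<otimes> z \<otimes> a) = star R a \<otimes> z \<otimes> a"
    using range_projection[OF sa] star_star[OF a] by auto
  define p q where "p = a \<otimes> y \<otimes> star R a" and "q = star R a \<otimes> z \<otimes> a"
  have p: "p \<in> carrier R" "p \<otimes> a = a" "star R p = p"
    using y a sa by (auto simp: p_def closed_simps)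
  have q: "q \<in> carrier R" "star R q = q" and "q \<otimes> star R a = star R a"
    using z a sa by (auto simp: q_def closed_simps)
  then have aq: "a \<otimes> q = a" using a by (metis star_mult star_star star_closed)
  obtain x where x: "x \<in> carrier R" "a \<otimes> x \<otimes> a = a"
    using regular a by (auto simp: von_neumann_regular_def)
  define w where "w = q \<otimes> x \<otimes> p"
  have w: "w \<in> carrier R" using p q x by (simp add: w_def closed_simps)
  have aw: "a \<otimes> w = p"
  proof -
    have "a \<otimes> w = a \<otimes> q \<otimes> x \<otimes> p" using a p q x by (simp add: w_def closed_simps mult_assoc)
    also have "\<dots> = a \<otimes> x \<otimes> a \<otimes> y \<otimes> star R a"
      using aq a x(1) y(1) sa by (simp add: p_def closed_simps mult_assoc)
    finally show ?thesis using x by (simp add: p_def)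
  qed
  have wa: "w \<otimes> a = q"
  proof -
    have "w \<otimes> a = q \<otimes> x \<otimes> (p \<otimes> a)" using a p(1) q x by (simp add: w_def closed_simps mult_assoc)
    also have "\<dots> = star R a \<otimes> z \<otimes> (a \<otimes> x \<otimes> a)"
      using p(2) a x z sa by (simp add: q_def closed_simps mult_assoc)
    finally show ?thesis using x by (simp add: q_def)
  qed
  have "q \<otimes> q = q" using wa aq w a q by (metis mult_assoc)
  then have "w \<otimes> a \<otimes> w = w"
    using wa p q x by (metis mult_assoc mult_closed w_def)
  then show ?thesis
    using w a p q aw wa by (auto simp: is_pseudo_inverse_def)
qed

lemma pseudo_inverse_unique:
  assumes a: "a \<in> carrier R" and x: "is_pseudo_inverse R a x" and y: "is_pseudo_inverse R a y"
  shows "x = y"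
proof -
  have c: "x \<in> carrier R" "y \<in> carrier R"
    using x y by (auto simp: is_pseudo_inverse_def)
  have X: "a \<otimes> x \<otimes> a = a" "x \<otimes> a \<otimes> x = x" "star R (a \<otimes> x) = a \<otimes> x" "star R (x \<otimes> a) = x \<otimes> a"
   and Y: "a \<otimes> y \<otimes> a = a" "y \<otimes> a \<otimes> y = y" "star R (a \<otimes> y) = a \<otimes> y" "star R (y \<otimes> a) = y \<otimes> a"
    using x y by (auto simp: is_pseudo_inverse_def)
  have "a \<otimes> x = star R (a \<otimes> y \<otimes> (a \<otimes> x))"
    using X Y a c by (metis mult_assoc mult_closed)
  also have "\<dots> = a \<otimes> x \<otimes> (a \<otimes> y)"
    using X Y a c by (metis star_mult mult_closed)
  also have "\<dots> = a \<otimes> y" using X Y a c by (metis mult_assoc mult_closed)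
  finally have 1: "a \<otimes> x = a \<otimes> y" .
  have "x \<otimes> a = star R (x \<otimes> a \<otimes> (y \<otimes> a))"
    using X Y a c by (metis mult_assoc mult_closed)
  also have "\<dots> = y \<otimes> a \<otimes> (x \<otimes> a)"
    using X Y a c by (metis star_mult mult_closed)
  also have "\<dots> = y \<otimes> a" using X Y a c by (metis mult_assoc mult_closed)
  finally show ?thesis using 1 X Y a c by (metis mult_assoc)
qed

lemma pseudo_inverse_eqI:
  "\<lbrakk>a \<in> carrier R; is_pseudo_inverse R a x\<rbrakk> \<Longrightarrow> pseudo_inverse R a = x"
  using pseudo_inverse_unique by (auto simp: pseudo_inverse_def intro!: the_equality)

lemma is_pseudo_inverse: "a \<in> carrier R \<Longrightarrow> is_pseudo_inverse R a (pseudo_inverse R a)"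
  using pseudo_inverse_exists pseudo_inverse_eqI by metis

lemma pseudo_inverse_closed: "a \<in> carrier R \<Longrightarrow> pseudo_inverse R a \<in> carrier R"
  and pseudo_inverse_inner: "a \<in> carrier R \<Longrightarrow> a \<otimes> pseudo_inverse R a \<otimes> a = a"
  and pseudo_inverse_outer: "a \<in> carrier R \<Longrightarrow>
    pseudo_inverse R a \<otimes> a \<otimes> pseudo_inverse R a = pseudo_inverse R a"
  and star_range: "a \<in> carrier R \<Longrightarrow> star R (a \<otimes> pseudo_inverse R a) = a \<otimes> pseudo_inverse R a"
  and star_corange: "a \<in> carrier R \<Longrightarrow> star R (pseudo_inverse R a \<otimes> a) = pseudo_inverse R a \<otimes> a"
  using is_pseudo_inverse by (auto simp: is_pseudo_inverse_def)

lemma pseudo_inverse_star: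
  assumes "a \<in> carrier R"
  shows "pseudo_inverse R (star R a) = star R (pseudo_inverse R a)"
proof (rule pseudo_inverse_eqI)
  let ?x = "pseudo_inverse R a"
  note c = assms pseudo_inverse_closed[OF assms]
  show "is_pseudo_inverse R (star R a) (star R ?x)"
    unfolding is_pseudo_inverse_def
    using c pseudo_inverse_inner[OF assms] pseudo_inverse_outer[OF assms]
      star_range[OF assms] star_corange[OF assms]
    by (metis star_closed star_mult mult_closed mult_assoc)
qed (simp add: assms star_closed)

lemma pseudo_inverse_factor_star:
  assumes "a \<in> carrier R"
  shows "pseudo_inverse R a \<otimes> star R (pseudo_inverse R a) \<otimes> star R a = pseudo_inverse R a"
  by (metis assms mult_assoc pseudo_inverse_closed pseudo_inverse_outer star_closed star_mult
      star_range)

lemma pseudo_inverse_mult_star: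
  assumes "a \<in> carrier R"
  shows "pseudo_inverse R a \<otimes> a \<otimes> star R a = star R a"
  by (metis assms mult_assoc mult_closed pseudo_inverse_closed pseudo_inverse_inner star_corange star_mult)

lemma star_mult_range:
  assumes "a \<in> carrier R"
  shows "star R a \<otimes> a \<otimes> pseudo_inverse R a = star R a"
  by (metis assms mult_assoc mult_closed pseudo_inverse_closed pseudo_inverse_inner star_closed star_mult star_range)

lemma factor_mult_star:
  assumes "a \<in> carrier R"
  shows "a \<otimes> star R a \<otimes> star R (pseudo_inverse R a) = a"
  by (metis assms mult_assoc pseudo_inverse_closed pseudo_inverse_inner star_closed star_corange star_mult)

lemma star_factor_pseudo_inverse:
  assumes "a \<in> carrier R"
  shows "star R a \<otimes> star R (pseudo_inverse R a) \<otimes> pseudo_inverse R a = pseudo_inverse R a"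
  by (metis assms pseudo_inverse_closed pseudo_inverse_outer star_corange star_mult)

text \<open>Write \<open>a\<^sup>+\<close> for the pseudo-inverse of \<open>a\<close>.  Since \<open>a\<^sup>+ = a\<^sup>+(a\<^sup>+)\<^sup>*a\<^sup>*\<close>, the value \<open>a\<^sup>+x\<close> depends
  only on \<open>a\<^sup>*x\<close>, and the first two equations allow \<open>x\<close> to be replaced by \<open>rr\<^sup>+x\<close>.  The third
  turns this into \<open>az\<close> with \<open>z = r\<^sup>+x\<close>, and the fourth says that \<open>z\<close> has the form \<open>a\<^sup>*w\<close>, so that it
  is fixed by \<open>a\<^sup>+a\<close>.\<close>

lemma pseudo_inverse_local:
  fixes r
  defines "r' \<equiv> pseudo_inverse R r"
  assumes a: "a \<in> carrier R" and r: "r \<in> carrier R" and x: "x \<in> carrier R"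
    and 1: "star R a \<otimes> x = star R r \<otimes> x"
    and 2: "star R a \<otimes> (r \<otimes> r' \<otimes> x) = star R r \<otimes> (r \<otimes> r' \<otimes> x)"
    and 3: "a \<otimes> (r' \<otimes> x) = r \<otimes> (r' \<otimes> x)"
    and 4: "star R a \<otimes> (star R r' \<otimes> r' \<otimes> x) = star R r \<otimes> (star R r' \<otimes> r' \<otimes> x)"
  shows "pseudo_inverse R a \<otimes> x = r' \<otimes> x"
proof -
  let ?a = "pseudo_inverse R a"
  note c = a r x r'_def pseudo_inverse_closed[OF a] pseudo_inverse_closed[OF r, folded r'_def]
    star_closed mult_closed
  note fac = pseudo_inverse_factor_star[OF a]
  have "star R r \<otimes> x = star R r \<otimes> (r \<otimes> r' \<otimes> x)"
    using star_mult_range[OF r, folded r'_def] c by (metis mult_assoc)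
  then have "star R a \<otimes> x = star R a \<otimes> (r \<otimes> r' \<otimes> x)" using 1 2 by simp
  then have "?a \<otimes> x = ?a \<otimes> (r \<otimes> r' \<otimes> x)"
    using fac c by (metis (no_types, lifting) mult_assoc)
  also have "\<dots> = ?a \<otimes> (a \<otimes> (r' \<otimes> x))" using 3 c by (metis mult_assoc)
  also have "r' \<otimes> x = star R a \<otimes> (star R r' \<otimes> r' \<otimes> x)"
    using 4 star_factor_pseudo_inverse[OF r, folded r'_def] c by (metis mult_assoc)
  also have "?a \<otimes> (a \<otimes> \<dots>) = \<dots>"
    using pseudo_inverse_mult_star[OF a] c by (metis mult_assoc)
  finally show ?thesis
    using 4 star_factor_pseudo_inverse[OF r, folded r'_def] c by (metis mult_assoc)
qed

end

section \<open>Homomorphisms, subrings and identities\<close>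

lemma star_ring_homD:
  assumes "h \<in> star_ring_hom u R Q"
  shows "a \<in> carrier R \<Longrightarrow> h a \<in> carrier Q"
    and "\<lbrakk>a \<in> carrier R; b \<in> carrier R\<rbrakk> \<Longrightarrow> h (a \<otimes>\<^bsub>R\<^esub> b) = h a \<otimes>\<^bsub>Q\<^esub> h b"
    and "\<lbrakk>a \<in> carrier R; b \<in> carrier R\<rbrakk> \<Longrightarrow> h (a \<oplus>\<^bsub>R\<^esub> b) = h a \<oplus>\<^bsub>Q\<^esub> h b"
    and "a \<in> carrier R \<Longrightarrow> h (star R a) = star Q (h a)"
    and "u \<Longrightarrow> h \<one>\<^bsub>R\<^esub> = \<one>\<^bsub>Q\<^esub>"
  using assms by (auto simp: star_ring_hom_def hom_def Pi_iff)

lemma star_ring_homI: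
  assumes "\<And>a. a \<in> carrier R \<Longrightarrow> h a \<in> carrier Q"
    and "\<And>a b. \<lbrakk>a \<in> carrier R; b \<in> carrier R\<rbrakk> \<Longrightarrow> h (a \<otimes>\<^bsub>R\<^esub> b) = h a \<otimes>\<^bsub>Q\<^esub> h b"
    and "\<And>a b. \<lbrakk>a \<in> carrier R; b \<in> carrier R\<rbrakk> \<Longrightarrow> h (a \<oplus>\<^bsub>R\<^esub> b) = h a \<oplus>\<^bsub>Q\<^esub> h b"
    and "\<And>a. a \<in> carrier R \<Longrightarrow> h (star R a) = star Q (h a)"
    and "u \<Longrightarrow> h \<one>\<^bsub>R\<^esub> = \<one>\<^bsub>Q\<^esub>"
  shows "h \<in> star_ring_hom u R Q"
  using assms by (auto simp: star_ring_hom_def hom_def Pi_iff)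

lemma star_ring_hom_zero:
  assumes "star_ring u R" "star_ring u Q" "h \<in> star_ring_hom u R Q"
  shows "h \<zero>\<^bsub>R\<^esub> = \<zero>\<^bsub>Q\<^esub>"
proof -
  interpret R: star_ring u R by fact
  interpret Q: star_ring u Q by fact
  note h = star_ring_homD[OF assms(3)]
  have "h \<zero>\<^bsub>R\<^esub> \<oplus>\<^bsub>Q\<^esub> h \<zero>\<^bsub>R\<^esub> = h \<zero>\<^bsub>R\<^esub>" using h(3)[of "\<zero>\<^bsub>R\<^esub>" "\<zero>\<^bsub>R\<^esub>"] by simp
  then show ?thesis using h(1)[of "\<zero>\<^bsub>R\<^esub>"] Q.add.r_cancel_one[of "h \<zero>\<^bsub>R\<^esub>" "h \<zero>\<^bsub>R\<^esub>"] by simp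
qed

lemma star_ring_hom_minus:
  assumes "star_ring u R" "star_ring u Q" "h \<in> star_ring_hom u R Q" "a \<in> carrier R"
  shows "h (\<ominus>\<^bsub>R\<^esub> a) = \<ominus>\<^bsub>Q\<^esub> h a"
proof -
  interpret R: star_ring u R by fact
  interpret Q: star_ring u Q by fact
  note h = star_ring_homD[OF assms(3)]
  have "h (\<ominus>\<^bsub>R\<^esub> a) \<oplus>\<^bsub>Q\<^esub> h a = \<zero>\<^bsub>Q\<^esub>"
    using star_ring_hom_zero[OF assms(1-3)] h(3)[of "\<ominus>\<^bsub>R\<^esub> a" a] assms(4) by (simp add: R.l_neg)
  then show ?thesis using h(1) assms(4) Q.minus_equality[of "h (\<ominus>\<^bsub>R\<^esub> a)" "h a"] by simp
qed

lemma star_ring_hom_pseudo_inverse: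
  assumes "star_regular u R" "star_regular u Q" "h \<in> star_ring_hom u R Q" "a \<in> carrier R"
  shows "h (pseudo_inverse R a) = pseudo_inverse Q (h a)"
proof -
  interpret R: star_regular_ring u R using assms(1) by (simp add: star_regular_iff)
  interpret Q: star_regular_ring u Q using assms(2) by (simp add: star_regular_iff)
  note h = star_ring_homD[OF assms(3)]
  have "is_pseudo_inverse Q (h a) (h (pseudo_inverse R a))"
    using R.is_pseudo_inverse[OF assms(4)] assms(4) h
    unfolding is_pseudo_inverse_def by (simp flip: h(2,4) add: R.mult_closed)
  then show ?thesis using Q.pseudo_inverse_eqI h(1) assms(4) by metis
qed

lemma interp_closed:
  assumes "star_regular u R" "in_signature u t" "\<And>n. v n \<in> carrier R"
  shows "interp R v t \<in> carrier R"
proof -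
  interpret star_regular_ring u R using assms(1) by (simp add: star_regular_iff)
  show ?thesis using assms(2,3)
    by (induction t) (auto simp: closed_simps pseudo_inverse_closed)
qed

lemma interp_hom:
  assumes "star_regular u R" "star_regular u Q" "h \<in> star_ring_hom u R Q"
    and "in_signature u t" "\<And>n. v n \<in> carrier R"
  shows "interp Q (\<lambda>n. h (v n)) t = h (interp R v t)"
proof -
  have R: "star_ring u R" and Q: "star_ring u Q" using assms(1,2) by (auto simp: star_regular_def)
  note h = star_ring_homD[OF assms(3)] star_ring_hom_zero[OF R Q assms(3)]
    star_ring_hom_minus[OF R Q assms(3)] star_ring_hom_pseudo_inverse[OF assms(1-3)]
  show ?thesis using assms(4)
    by (induction t) (auto simp: h interp_closed[OF assms(1) _ assms(5)])
qed

lemma satisfies_image: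
  assumes "star_regular u R" "star_regular u Q" "h \<in> star_ring_hom u R Q" "h ` carrier R = carrier Q"
    and "in_signature u s" "in_signature u t" "satisfies R s t"
  shows "satisfies Q s t"
  unfolding satisfies_def
proof (intro allI impI)
  fix v :: "nat \<Rightarrow> _" assume v: "\<forall>n. v n \<in> carrier Q"
  then have "\<forall>n. \<exists>w. w \<in> carrier R \<and> h w = v n" using assms(4) by (metis imageE)
  then obtain w where w: "\<And>n. w n \<in> carrier R" "\<And>n. h (w n) = v n" by metis
  then have "interp R w s = interp R w t" using assms(7) by (simp add: satisfies_def)
  then show "interp Q v s = interp Q v t"
    using interp_hom[OF assms(1-3) assms(5), of w] interp_hom[OF assms(1-3) assms(6), of w] w by simp
qed

lemma satisfies_embedded:
  assumes "star_regular u R" "star_regular u Q" "h \<in> star_ring_hom u Q R" "inj_on h (carrier Q)"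
    and "in_signature u s" "in_signature u t" "satisfies R s t"
  shows "satisfies Q s t"
  unfolding satisfies_def
proof (intro allI impI)
  fix v :: "nat \<Rightarrow> _" assume v: "\<forall>n. v n \<in> carrier Q"
  then have "interp R (\<lambda>n. h (v n)) s = interp R (\<lambda>n. h (v n)) t"
    using assms(7) star_ring_homD(1)[OF assms(3)] by (simp add: satisfies_def)
  then have "h (interp Q v s) = h (interp Q v t)"
    using interp_hom[OF assms(2,1,3,5), of v] interp_hom[OF assms(2,1,3,6), of v] v by simp
  then show "interp Q v s = interp Q v t"
    using inj_onD[OF assms(4)] interp_closed[OF assms(2,5)] interp_closed[OF assms(2,6)] v by metis
qed

lemma star_ring_image:
  assumes R: "star_ring u R" and hom: "h \<in> star_ring_hom u R Q"
    and onto: "h ` carrier R = carrier Q" and zero: "h \<zero>\<^bsub>R\<^esub> = \<zero>\<^bsub>Q\<^esub>"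
  shows "star_ring u Q"
proof -
  interpret R: star_ring u R by fact
  note h = star_ring_homD(2-5)[OF hom, symmetric] zero[symmetric]
  have img: "\<And>a. a \<in> carrier R \<Longrightarrow> h a \<in> carrier Q" using onto by auto
  have rng: "\<exists>b\<in>carrier R. a = h b" if "a \<in> carrier Q" for a using that onto by auto
  show ?thesis
  proof (rule star_ringI)
    show "abelian_group Q"
    proof (rule abelian_groupI)
      fix x assume "x \<in> carrier Q"
      then obtain a where a: "a \<in> carrier R" "x = h a" using rng by blast
      then have "h (\<ominus>\<^bsub>R\<^esub> a) \<oplus>\<^bsub>Q\<^esub> x = \<zero>\<^bsub>Q\<^esub>" by (simp add: h R.l_neg)
      then show "\<exists>y\<in>carrier Q. y \<oplus>\<^bsub>Q\<^esub> x = \<zero>\<^bsub>Q\<^esub>" using img a by blast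
    qed (auto dest!: rng simp: h img R.a_ac)
  qed (auto dest!: rng simp: h img R.closed_simps R.mult_assoc R.distrib_left R.distrib_right
      R.unit_left R.unit_right R.star_add R.star_mult R.star_star)
qed

text \<open>A homomorphism kills \<open>a\<close> as soon as it kills \<open>a \<otimes> star a\<close>, since
  \<open>a = a \<otimes> star a \<otimes> star (pseudo_inverse a)\<close>; hence properness passes to images.\<close>

lemma star_regular_image:
  assumes R: "star_regular u R" and hom: "h \<in> star_ring_hom u R Q"
    and onto: "h ` carrier R = carrier Q" and zero: "h \<zero>\<^bsub>R\<^esub> = \<zero>\<^bsub>Q\<^esub>"
  shows "star_regular u Q"
proof -
  interpret R: star_regular_ring u R using R by (simp add: star_regular_iff)
  have Q: "star_ring u Q" using star_ring_image[OF R.star_ring_axioms hom onto zero] .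
  then interpret Q: star_ring u Q .
  note h = star_ring_homD[OF hom]
  have rng: "\<exists>b\<in>carrier R. a = h b" if "a \<in> carrier Q" for a using that onto by auto
  have "proper Q" unfolding proper_def
  proof (intro ballI impI)
    fix x assume x: "x \<in> carrier Q" "x \<otimes>\<^bsub>Q\<^esub> star Q x = \<zero>\<^bsub>Q\<^esub>"
    obtain a where a: "a \<in> carrier R" "x = h a" using x rng by blast
    let ?y = "star R (pseudo_inverse R a)"
    have y: "?y \<in> carrier R" using a by (simp add: R.star_closed R.pseudo_inverse_closed)
    have "x = h (a \<otimes>\<^bsub>R\<^esub> star R a \<otimes>\<^bsub>R\<^esub> ?y)" using a R.factor_mult_star by simp
    also have "\<dots> = (x \<otimes>\<^bsub>Q\<^esub> star Q x) \<otimes>\<^bsub>Q\<^esub> h ?y"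
      using a y by (simp add: h R.closed_simps)
    also have "\<dots> = \<zero>\<^bsub>Q\<^esub>" using x(2) y h(1) Q.zero_mult by simp
    finally show "x = \<zero>\<^bsub>Q\<^esub>" .
  qed
  moreover have "von_neumann_regular Q" unfolding von_neumann_regular_def
  proof
    fix x assume "x \<in> carrier Q"
    then obtain a where a: "a \<in> carrier R" "x = h a" using rng by blast
    from a(1) have "x \<otimes>\<^bsub>Q\<^esub> h (pseudo_inverse R a) \<otimes>\<^bsub>Q\<^esub> x = x"
      unfolding a(2) by (simp flip: h(2) add: R.pseudo_inverse_closed R.pseudo_inverse_inner R.mult_closed)
    then show "\<exists>y\<in>carrier Q. x \<otimes>\<^bsub>Q\<^esub> y \<otimes>\<^bsub>Q\<^esub> x = x"
      using a(1) R.pseudo_inverse_closed h(1) by (intro bexI[of _ "h (pseudo_inverse R a)"]) simp_all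
  qed
  ultimately show ?thesis using Q by (simp add: star_regular_def)
qed

lemma star_regular_subring:
  assumes R: "star_ring u R" and proper: "proper R" and S: "star_subring u S R"
    and inner: "\<And>a. a \<in> S \<Longrightarrow> \<exists>x\<in>S. a \<otimes>\<^bsub>R\<^esub> x \<otimes>\<^bsub>R\<^esub> a = a"
  shows "star_regular u (R\<lparr>carrier := S\<rparr>)"
proof -
  interpret R: star_ring u R by fact
  have sub: "S \<subseteq> carrier R" "\<zero>\<^bsub>R\<^esub> \<in> S" "\<And>x y. x \<in> S \<Longrightarrow> y \<in> S \<Longrightarrow> x \<oplus>\<^bsub>R\<^esub> y \<in> S"
    "\<And>x. x \<in> S \<Longrightarrow> \<ominus>\<^bsub>R\<^esub> x \<in> S" "\<And>x y. x \<in> S \<Longrightarrow> y \<in> S \<Longrightarrow> x \<otimes>\<^bsub>R\<^esub> y \<in> S"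
    "\<And>x. x \<in> S \<Longrightarrow> star R x \<in> S" "u \<Longrightarrow> \<one>\<^bsub>R\<^esub> \<in> S"
    using S by (auto simp: star_subring_def R.additive_subgroup_iff)
  have c: "\<And>x. x \<in> S \<Longrightarrow> x \<in> carrier R" using sub(1) by auto
  have "star_ring u (R\<lparr>carrier := S\<rparr>)"
  proof (rule star_ringI)
    show "abelian_group (R\<lparr>carrier := S\<rparr>)"
    proof (rule abelian_groupI)
      fix x assume "x \<in> carrier (R\<lparr>carrier := S\<rparr>)"
      then show "\<exists>y\<in>carrier (R\<lparr>carrier := S\<rparr>). y \<oplus>\<^bsub>R\<lparr>carrier := S\<rparr>\<^esub> x = \<zero>\<^bsub>R\<lparr>carrier := S\<rparr>\<^esub>"
        using sub(4)[of x] c[of x] R.l_neg[of x] by (intro bexI[of _ "\<ominus>\<^bsub>R\<^esub> x"]) simp_all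
    qed (simp_all add: sub c R.a_ac)
  qed (simp_all add: sub c R.mult_assoc R.distrib_left R.distrib_right
      R.unit_left R.unit_right R.star_add R.star_mult R.star_star)
  moreover have "proper (R\<lparr>carrier := S\<rparr>)" using proper c by (simp add: proper_def)
  moreover have "von_neumann_regular (R\<lparr>carrier := S\<rparr>)"
    using inner by (simp add: von_neumann_regular_def)
  ultimately show ?thesis by (simp add: star_regular_def)
qed

context star_ring
begin

lemma two_sided_idealD:
  assumes "two_sided_ideal J R"
  shows "J \<subseteq> carrier R" "\<zero> \<in> J" "\<lbrakk>x \<in> J; y \<in> J\<rbrakk> \<Longrightarrow> x \<oplus> y \<in> J" "x \<in> J \<Longrightarrow> \<ominus> x \<in> J"
    "\<lbrakk>x \<in> J; y \<in> carrier R\<rbrakk> \<Longrightarrow> x \<otimes> y \<in> J" "\<lbrakk>x \<in> J; y \<in> carrier R\<rbrakk> \<Longrightarrow> y \<otimes> x \<in> J"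
  using assms by (auto simp: two_sided_ideal_def additive_subgroup_iff)

lemma two_sided_idealI:
  assumes "J \<subseteq> carrier R" "\<zero> \<in> J" "\<And>x y. \<lbrakk>x \<in> J; y \<in> J\<rbrakk> \<Longrightarrow> x \<oplus> y \<in> J" "\<And>x. x \<in> J \<Longrightarrow> \<ominus> x \<in> J"
    "\<And>x y. \<lbrakk>x \<in> J; y \<in> carrier R\<rbrakk> \<Longrightarrow> x \<otimes> y \<in> J" "\<And>x y. \<lbrakk>x \<in> J; y \<in> carrier R\<rbrakk> \<Longrightarrow> y \<otimes> x \<in> J"
  shows "two_sided_ideal J R"
  using assms by (auto simp: two_sided_ideal_def additive_subgroup_iff)

end

section \<open>Corners\<close>

context star_regular_ring
begin

lemma projectionD:
  assumes "is_projection R e"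
  shows "e \<in> carrier R" "e \<otimes> e = e" "star R e = e"
  using assms by (auto simp: is_projection_def)

lemma range_is_projection: "a \<in> carrier R \<Longrightarrow> is_projection R (a \<otimes> pseudo_inverse R a)"
  unfolding is_projection_def
  by (metis mult_assoc mult_closed pseudo_inverse_closed pseudo_inverse_outer star_range)

text \<open>Commuting with \<open>a\<close> makes \<open>e\<close> preserve the range and, dually, the corange of \<open>a\<close>; being
  self-adjoint, \<open>e\<close> then commutes with the projections \<open>p\<close> and \<open>q\<close> onto them.\<close>

lemma commuting_pseudo_inverse:
  assumes e: "is_projection R e" and a: "a \<in> carrier R" and com: "e \<otimes> a = a \<otimes> e"
  shows "e \<otimes> pseudo_inverse R a = pseudo_inverse R a \<otimes> e"
proof -
  let ?b = "pseudo_inverse R a"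
  note E = projectionD[OF e]
  note c = E(1) a pseudo_inverse_closed[OF a] mult_closed star_closed
  note A = pseudo_inverse_inner[OF a] pseudo_inverse_outer[OF a]
  define p q where "p = a \<otimes> ?b" and "q = ?b \<otimes> a"
  have p: "p \<in> carrier R" "star R p = p" "p \<otimes> a = a" "?b \<otimes> p = ?b"
    and q: "q \<in> carrier R" "star R q = q" "a \<otimes> q = a" "q \<otimes> ?b = ?b"
    using A c star_range[OF a] star_corange[OF a] by (simp_all add: p_def q_def mult_assoc)
  have "e \<otimes> p = p \<otimes> e \<otimes> p"
    using com p c by (metis mult_assoc p_def)
  then have pe: "e \<otimes> p = p \<otimes> e" using p E c by (metis mult_assoc star_mult)
  have "q \<otimes> e = q \<otimes> e \<otimes> q"
    using com q c by (metis mult_assoc q_def)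
  then have qe: "e \<otimes> q = q \<otimes> e" using q E c by (metis mult_assoc star_mult)
  have "?b \<otimes> e = ?b \<otimes> e \<otimes> p" using p pe c by (metis mult_assoc)
  also have "\<dots> = q \<otimes> e \<otimes> ?b" using com c by (simp add: p_def q_def mult_assoc) (metis mult_assoc)
  also have "\<dots> = e \<otimes> ?b" using q qe c by (metis mult_assoc)
  finally show ?thesis by simp
qed


lemma star_regular_forget_unit: "star_regular False R"
  using star_ring_axioms proper regular
  by (auto simp: star_regular_def star_ring_def star_ring_axioms_def)

lemma corner_carrier:
  assumes e: "is_projection R e"
  shows "carrier (corner R e) = {x \<in> carrier R. e \<otimes> x = x \<and> x \<otimes> e = x}"
proof -
  note E = projectionD[OF e]
  have "e \<otimes> (e \<otimes> x \<otimes> e) = e \<otimes> x \<otimes> e" "e \<otimes> x \<otimes> e \<otimes> e = e \<otimes> x \<otimes> e" if "x \<in> carrier R" for x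
    using E that by (simp_all add: mult_closed mult_assoc) (metis mult_assoc mult_closed)
  then show ?thesis
    using E unfolding corner_def by (auto simp: mult_closed) metis
qed

lemma corner_simps [simp]:
  "x \<otimes>\<^bsub>corner R e\<^esub> y = x \<otimes> y" "x \<oplus>\<^bsub>corner R e\<^esub> y = x \<oplus> y" "\<zero>\<^bsub>corner R e\<^esub> = \<zero>"
  "\<one>\<^bsub>corner R e\<^esub> = e" "star (corner R e) x = star R x"
  by (simp_all add: corner_def)

definition commutant :: "'a \<Rightarrow> 'a set" where
  "commutant e = {x \<in> carrier R. e \<otimes> x = x \<otimes> e}"

lemma star_regular_commutant:
  assumes e: "is_projection R e"
  shows "star_regular u (R\<lparr>carrier := commutant e\<rparr>)"
proof (rule star_regular_subring[OF star_ring_axioms proper])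
  note E = projectionD[OF e]
  have star: "e \<otimes> star R x = star R x \<otimes> e" if "x \<in> carrier R" "e \<otimes> x = x \<otimes> e" for x
    using that E by (metis star_mult)
  have mult: "e \<otimes> (x \<otimes> y) = x \<otimes> y \<otimes> e" if "x \<in> carrier R" "e \<otimes> x = x \<otimes> e"
    "y \<in> carrier R" "e \<otimes> y = y \<otimes> e" for x y
    using that E by (metis mult_assoc)
  show "star_subring u (commutant e) R"
    using E by (auto simp: star_subring_def additive_subgroup_iff commutant_def closed_simps
      mult_zero zero_mult distrib_left distrib_right mult_minus minus_mult unit_left unit_right
      intro: star mult)
  show "\<exists>x\<in>commutant e. a \<otimes> x \<otimes> a = a" if "a \<in> commutant e" for a
    using that commuting_pseudo_inverse[OF e] pseudo_inverse_closed pseudo_inverse_inner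
    by (intro bexI[of _ "pseudo_inverse R a"]) (auto simp: commutant_def)
qed

text \<open>On all of \<open>R\<close> compression by \<open>e\<close> need not be multiplicative, but on the commutant of \<open>e\<close> it is
  a homomorphism, and it maps the unit of \<open>R\<close> to that of the corner; this is how corners inherit
  identities in both signatures.\<close>

lemma compression_hom:
  assumes e: "is_projection R e"
  shows "(\<lambda>x. e \<otimes> x) \<in> star_ring_hom u (R\<lparr>carrier := commutant e\<rparr>) (corner R e)"
    and "(\<lambda>x. e \<otimes> x) ` commutant e = carrier (corner R e)"
proof -
  note E = projectionD[OF e]
  have idem: "e \<otimes> (e \<otimes> x) = e \<otimes> x" if "x \<in> carrier R" for x
    using that E by (metis mult_assoc)
  have com: "e \<otimes> x \<otimes> e = e \<otimes> x" if "x \<in> carrier R" "e \<otimes> x = x \<otimes> e" for x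
    using that E by (metis mult_assoc)
  have mult: "e \<otimes> (x \<otimes> y) = e \<otimes> x \<otimes> (e \<otimes> y)" if "x \<in> carrier R" "e \<otimes> x = x \<otimes> e" "y \<in> carrier R" for x y
    using that E com[OF that(1,2)] by (metis mult_assoc mult_closed)
  show "(\<lambda>x. e \<otimes> x) \<in> star_ring_hom u (R\<lparr>carrier := commutant e\<rparr>) (corner R e)"
    using E by (intro star_ring_homI) (auto simp: corner_carrier[OF e] commutant_def closed_simps
      idem com mult distrib_left star_mult unit_right mult_assoc)
  show "(\<lambda>x. e \<otimes> x) ` commutant e = carrier (corner R e)"
  proof (intro equalityI subsetI)
    fix x assume "x \<in> (\<lambda>x. e \<otimes> x) ` commutant e"
    then show "x \<in> carrier (corner R e)"
      using E idem com by (force simp: corner_carrier[OF e] commutant_def mult_closed)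
  next
    fix x assume "x \<in> carrier (corner R e)"
    then show "x \<in> (\<lambda>x. e \<otimes> x) ` commutant e"
      by (intro image_eqI[of _ _ x]) (auto simp: corner_carrier[OF e] commutant_def)
  qed
qed

lemma star_regular_corner:
  assumes e: "is_projection R e"
  shows "star_regular u (corner R e)"
  using star_regular_image[OF star_regular_commutant[OF e] compression_hom(1)[OF e]]
    compression_hom(2)[OF e] projectionD(1)[OF e] mult_zero by simp

lemma satisfies_corner:
  assumes e: "is_projection R e" and sig: "in_signature u s" "in_signature u t"
    and sat: "satisfies R s t"
  shows "satisfies (corner R e) s t"
proof -
  have R: "star_regular u R"
    using star_ring_axioms proper regular by (simp add: star_regular_def)
  have "(\<lambda>x. x) \<in> star_ring_hom u (R\<lparr>carrier := commutant e\<rparr>) R"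
    by (rule star_ring_homI) (auto simp: commutant_def)
  from satisfies_embedded[OF R star_regular_commutant[OF e] this _ sig sat]
  have "satisfies (R\<lparr>carrier := commutant e\<rparr>) s t" by simp
  then show ?thesis
    using satisfies_image[OF star_regular_commutant[OF e] star_regular_corner[OF e]
        compression_hom(1)[OF e] _ sig] compression_hom(2)[OF e] by simp
qed

text \<open>Negatives and pseudo-inverses do not mention the unit, so they may be compared along the
  inclusion of the corner into \<open>R\<close>, which in general is a homomorphism only in the signature
  without unit.\<close>

lemma corner_operations:
  assumes e: "is_projection R e" and a: "a \<in> carrier (corner R e)"
  shows "\<ominus>\<^bsub>corner R e\<^esub> a = \<ominus> a" and "pseudo_inverse (corner R e) a = pseudo_inverse R a"
proof -
  interpret C: star_regular_ring u "corner R e"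
    using star_regular_corner[OF e] by (simp add: star_regular_iff)
  have "(\<lambda>x. x) \<in> star_ring_hom False (corner R e) R"
    by (rule star_ring_homI) (auto simp: corner_carrier[OF e])
  note hom = this a
  have C: "star_regular False (corner R e)" and R: "star_regular False R"
    using C.star_regular_forget_unit star_regular_forget_unit by auto
  show "\<ominus>\<^bsub>corner R e\<^esub> a = \<ominus> a"
    using star_ring_hom_minus[OF _ _ hom] C R by (simp add: star_regular_def)
  show "pseudo_inverse (corner R e) a = pseudo_inverse R a"
    using star_ring_hom_pseudo_inverse[OF C R hom] by simp
qed

lemma ideal_star_closed:
  assumes "two_sided_ideal J R" "x \<in> J"
  shows "star R x \<in> J"
proof -
  have "x \<in> carrier R" using two_sided_idealD(1)[OF assms(1)] assms(2) by auto
  then show ?thesis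
    using star_mult_range[of x] two_sided_idealD(5,6)[OF assms(1)] assms(2)
    by (metis pseudo_inverse_closed star_closed)
qed

end

section \<open>The minimal ideal\<close>

locale subdirectly_irreducible_ring = star_regular_ring +
  fixes J :: "'a set"
  assumes minimal: "minimal_ideal R J"
begin

lemma J_ideal: "two_sided_ideal J R"
  using minimal by (simp add: minimal_ideal_def)

lemmas J_D = two_sided_idealD[OF J_ideal]

lemma J_carrier: "x \<in> J \<Longrightarrow> x \<in> carrier R"
  using J_D(1) by auto

lemma J_least: "\<lbrakk>two_sided_ideal K R; K \<noteq> {\<zero>}\<rbrakk> \<Longrightarrow> J \<subseteq> K"
  using minimal by (simp add: minimal_ideal_def)

lemma J_nonzero: "\<exists>x\<in>J. x \<noteq> \<zero>"
  using minimal J_D(2) by (auto simp: minimal_ideal_def)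

text \<open>A nonzero ideal \<open>K\<close> of \<open>corner R e\<close> is the trace of the ideal \<open>L\<close> below, which
  therefore contains \<open>J\<close> and with it \<open>e\<close>.\<close>

lemma corner_simple:
  assumes e: "is_projection R e" "e \<in> J" "e \<noteq> \<zero>"
  shows "is_simple (corner R e)"
  unfolding is_simple_def
proof (intro conjI allI impI)
  interpret C: star_regular_ring u "corner R e"
    using star_regular_corner[OF e(1)] by (simp add: star_regular_iff)
  note E = projectionD[OF e(1)]
  have eC: "e \<in> carrier (corner R e)" using E by (simp add: corner_carrier[OF e(1)])
  show "carrier (corner R e) \<noteq> {\<zero>\<^bsub>corner R e\<^esub>}" using eC e(3) by auto
  fix K assume K: "two_sided_ideal K (corner R e)"
  note KD = C.two_sided_idealD[OF K, simplified]
  define L where "L = {x \<in> carrier R. \<forall>r\<in>carrier R. \<forall>s\<in>carrier R. e \<otimes> r \<otimes> x \<otimes> (s \<otimes> e) \<in> K}"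
  have KC: "x \<in> carrier R \<and> e \<otimes> x = x \<and> x \<otimes> e = x" if "x \<in> K" for x
    using that KD(1) corner_carrier[OF e(1)] by auto
  have "K = carrier (corner R e)" if "K \<noteq> {\<zero>}"
  proof -
    obtain k where k: "k \<in> K" "k \<noteq> \<zero>" using \<open>K \<noteq> {\<zero>}\<close> KD(2) by auto
    have "two_sided_ideal L R"
    proof (rule two_sided_idealI)
      fix x assume x: "x \<in> L"
      show "\<ominus> x \<in> L" unfolding L_def
      proof (intro CollectI conjI ballI)
        fix r s assume rs: "r \<in> carrier R" "s \<in> carrier R"
        then have m: "e \<otimes> r \<otimes> x \<otimes> (s \<otimes> e) \<in> K" using x by (simp add: L_def)
        have "\<ominus>\<^bsub>corner R e\<^esub> (e \<otimes> r \<otimes> x \<otimes> (s \<otimes> e)) = \<ominus> (e \<otimes> r \<otimes> x \<otimes> (s \<otimes> e))"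
          using corner_operations(1)[OF e(1)] m KD(1) by blast
        then show "e \<otimes> r \<otimes> (\<ominus> x) \<otimes> (s \<otimes> e) \<in> K"
          using KD(4)[OF m] rs x E by (simp add: L_def mult_minus minus_mult mult_closed)
      qed (use x in \<open>simp add: L_def\<close>)
    next
      fix x y assume x: "x \<in> L" and y: "y \<in> carrier R"
      then have xc: "x \<in> carrier R" by (simp add: L_def)
      have "e \<otimes> r \<otimes> (x \<otimes> y) \<otimes> (s \<otimes> e) = e \<otimes> r \<otimes> x \<otimes> ((y \<otimes> s) \<otimes> e)"
       "e \<otimes> r \<otimes> (y \<otimes> x) \<otimes> (s \<otimes> e) = e \<otimes> (r \<otimes> y) \<otimes> x \<otimes> (s \<otimes> e)"
        if "r \<in> carrier R" "s \<in> carrier R" for r s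
        using that xc y E by (simp_all add: mult_assoc mult_closed)
      then show "x \<otimes> y \<in> L" "y \<otimes> x \<in> L"
        using x y xc by (auto simp: L_def mult_closed)
    qed (use E KD(2,3) in \<open>auto simp: L_def mult_zero zero_mult distrib_left distrib_right mult_closed\<close>)
    moreover have "k \<in> L" unfolding L_def
    proof (intro CollectI conjI ballI)
      show "k \<in> carrier R" using KC k by simp
      fix r s assume rs: "r \<in> carrier R" "s \<in> carrier R"
      have kk: "k = e \<otimes> k \<otimes> e" "k \<in> carrier R" using KC k by auto
      have c: "e \<otimes> r \<otimes> e \<in> carrier (corner R e)" "e \<otimes> s \<otimes> e \<in> carrier (corner R e)"
        using rs by (auto simp: corner_def)
      have "e \<otimes> r \<otimes> k \<otimes> (s \<otimes> e) = e \<otimes> r \<otimes> (e \<otimes> k \<otimes> e) \<otimes> (s \<otimes> e)" using kk by simp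
      also have "\<dots> = (e \<otimes> r \<otimes> e) \<otimes> k \<otimes> (e \<otimes> s \<otimes> e)"
        using rs E kk(2) by (simp add: mult_assoc mult_closed)
      also have "\<dots> \<in> K" using KD(5,6) k(1) c by simp
      finally show "e \<otimes> r \<otimes> k \<otimes> (s \<otimes> e) \<in> K" .
    qed
    ultimately have "e \<in> L" using J_least[of L] k(2) e(2) by auto
    then have "e \<otimes> e \<otimes> e \<otimes> (e \<otimes> e) \<in> K" using E(1) unfolding L_def by blast
    then have "e \<in> K" using E by simp
    then have "x \<in> K" if "x \<in> carrier (corner R e)" for x
      using KD(5)[OF _ that] that corner_carrier[OF e(1)] by fastforce
    then show ?thesis using KD(1) by auto
  qed
  then show "K = {\<zero>\<^bsub>corner R e\<^esub>} \<or> K = carrier (corner R e)" by auto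
qed

text \<open>Otherwise the annihilator of \<open>J\<close>, being a nonzero ideal, would contain \<open>J\<close>, and
  \<open>x = x \<otimes> (pseudo_inverse x \<otimes> x)\<close> would vanish for all \<open>x\<close> in \<open>J\<close>.\<close>

lemma J_faithful:
  assumes "r \<in> carrier R" "s \<in> carrier R" "\<And>x. x \<in> J \<Longrightarrow> r \<otimes> x = s \<otimes> x"
  shows "r = s"
proof (rule ccontr)
  assume ne: "r \<noteq> s"
  define K where "K = {a \<in> carrier R. \<forall>x\<in>J. a \<otimes> x = \<zero>}"
  have "two_sided_ideal K R"
    by (rule two_sided_idealI)
      (auto simp: K_def J_carrier J_D zero_mult distrib_right minus_mult mult_closed mult_assoc mult_zero)
  moreover have "r \<ominus> s \<in> K"
    using assms by (auto simp: K_def diff_mult J_carrier minus_zero_iff mult_closed)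
  moreover have "r \<ominus> s \<noteq> \<zero>" using ne assms minus_zero_iff by simp
  ultimately have JK: "J \<subseteq> K" using J_least by blast
  have "x = \<zero>" if "x \<in> J" for x
  proof -
    have "x \<otimes> (pseudo_inverse R x \<otimes> x) = \<zero>"
      using JK that J_D(6) pseudo_inverse_closed J_carrier by (auto simp: K_def)
    then show ?thesis
      using pseudo_inverse_inner[of x] pseudo_inverse_closed[of x] mult_assoc J_carrier[OF that] by simp
  qed
  then show False using J_nonzero by blast
qed

text \<open>The witness is the orthogonal sum of the projection onto \<open>x\<close> and of the projection onto
  the part of \<open>y\<close> orthogonal to \<open>x\<close>.\<close>

lemma J_directed:
  assumes x: "x \<in> J" and y: "y \<in> J"
  shows "\<exists>p\<in>J. is_projection R p \<and> p \<otimes> x = x \<and> p \<otimes> y = y"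
proof -
  note xc = J_carrier[OF x] and yc = J_carrier[OF y]
  define p where "p = x \<otimes> pseudo_inverse R x"
  define z where "z = y \<ominus> p \<otimes> y"
  define q where "q = z \<otimes> pseudo_inverse R z"
  have p: "p \<in> carrier R" "p \<in> J" "star R p = p" "p \<otimes> p = p" "p \<otimes> x = x"
    using projectionD[OF range_is_projection[OF xc]] pseudo_inverse_inner[OF xc]
      J_D(5)[OF x pseudo_inverse_closed[OF xc]] by (auto simp: p_def)
  have z: "z \<in> J" unfolding z_def a_minus_def using p y by (simp add: J_D)
  note zc = J_carrier[OF z]
  have q: "q \<in> carrier R" "q \<in> J" "star R q = q" "q \<otimes> q = q" "q \<otimes> z = z"
    using projectionD[OF range_is_projection[OF zc]] pseudo_inverse_inner[OF zc]
      J_D(5)[OF z pseudo_inverse_closed[OF zc]] by (auto simp: q_def)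
  have "p \<otimes> (p \<otimes> y) = p \<otimes> y" using p yc by (metis mult_assoc)
  then have "p \<otimes> z = \<zero>" using p yc by (simp add: z_def mult_diff mult_closed minus_zero_iff)
  then have pq: "p \<otimes> q = \<zero>" using p zc by (metis q_def mult_assoc pseudo_inverse_closed zero_mult)
  then have qp: "q \<otimes> p = \<zero>" using p q by (metis star_mult star_zero)
  have qx: "q \<otimes> x = \<zero>" using qp p q xc by (metis mult_assoc zero_mult)
  have qpy: "q \<otimes> (p \<otimes> y) = \<zero>" using qp p q yc by (metis mult_assoc zero_mult)
  have y_split: "y = p \<otimes> y \<oplus> z" using p yc unfolding z_def a_minus_def
    by (metis a_comm a_inv_closed a_assoc l_neg mult_closed r_zero)
  then have "q \<otimes> y = z" using qpy q p yc zc by (metis distrib_left l_zero mult_closed)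
  then have "(p \<oplus> q) \<otimes> y = y" using p q yc y_split by (simp add: distrib_right)
  moreover have "(p \<oplus> q) \<otimes> x = x" using p q xc qx by (simp add: distrib_right)
  moreover have "is_projection R (p \<oplus> q)"
    using p q pq qp by (simp add: is_projection_def distrib_left distrib_right star_add)
  ultimately show ?thesis using J_D(3) p q by blast
qed

end

section \<open>Quotients\<close>

text \<open>The quotient is carried by chosen representatives of the residue classes rather than by the
  classes themselves: a variety consists of rings over one type of elements, and the quotient has
  to be a candidate for membership in the same variety as \<open>R\<close>.\<close>

lemma (in star_regular_ring) exists_quotient:
  assumes K: "two_sided_ideal K R"
  shows "\<exists>(Q :: 'a star_ring) h. star_regular u Q \<and> h \<in> star_ring_hom u R Q \<and>
    h ` carrier R = carrier Q \<and> (\<forall>x\<in>carrier R. h x = \<zero>\<^bsub>Q\<^esub> \<longleftrightarrow> x \<in> K)"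
proof -
  note KD = two_sided_idealD[OF K]
  have KC: "\<And>k. k \<in> K \<Longrightarrow> k \<in> carrier R" using KD(1) by auto
  \<comment> \<open>Congruence modulo \<open>K\<close>; \<open>\<rho>\<close> below picks representatives of its classes.\<close>
  define E where "E x y \<longleftrightarrow> (\<exists>k\<in>K. x = k \<oplus> y)" for x y
  have refl: "E x x" if "x \<in> carrier R" for x
    using that KD(2) by (auto simp: E_def intro!: bexI[of _ \<zero>])
  have sym: "E y x" if "E x y" "y \<in> carrier R" for x y
  proof -
    obtain k where k: "k \<in> K" "x = k \<oplus> y" using \<open>E x y\<close> by (auto simp: E_def)
    then have "y = (\<ominus> k) \<oplus> x" using that(2) KC[OF k(1)] by (simp add: r_neg1)
    then show ?thesis using k KD(4) by (auto simp: E_def)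
  qed
  have trans: "E x z" if xyz: "E x y" "E y z" "z \<in> carrier R" for x y z
  proof -
    obtain k l where "k \<in> K" "x = k \<oplus> y" "l \<in> K" "y = l \<oplus> z"
      using xyz unfolding E_def by blast
    then have "x = (k \<oplus> l) \<oplus> z" "k \<oplus> l \<in> K" using xyz(3) KC KD(3) by (simp_all add: a_assoc)
    then show ?thesis by (auto simp: E_def)
  qed
  have add: "E (x \<oplus> y) (x' \<oplus> y')" if xy: "E x x'" "E y y'" "x' \<in> carrier R" "y' \<in> carrier R" for x y x' y'
  proof -
    obtain k l where "k \<in> K" "x = k \<oplus> x'" "l \<in> K" "y = l \<oplus> y'" using xy by (auto simp: E_def)
    then have "x \<oplus> y = (k \<oplus> l) \<oplus> (x' \<oplus> y')" "k \<oplus> l \<in> K"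
      using xy(3,4) KC KD(3) by (simp_all add: a_ac)
    then show ?thesis by (auto simp: E_def)
  qed
  have mult: "E (x \<otimes> y) (x' \<otimes> y')" if xy: "E x x'" "E y y'" "x' \<in> carrier R" "y' \<in> carrier R" for x y x' y'
  proof -
    obtain k l where kl: "k \<in> K" "x = k \<oplus> x'" "l \<in> K" "y = l \<oplus> y'" using xy by (auto simp: E_def)
    then have "x \<otimes> y = (k \<otimes> l \<oplus> (k \<otimes> y' \<oplus> x' \<otimes> l)) \<oplus> x' \<otimes> y'"
      using xy(3,4) KC by (simp add: distrib_left distrib_right mult_closed a_ac)
    moreover have "k \<otimes> l \<oplus> (k \<otimes> y' \<oplus> x' \<otimes> l) \<in> K" using kl xy(3,4) KC KD by simp
    ultimately show ?thesis by (auto simp: E_def)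
  qed
  have star: "E (star R x) (star R x')" if "E x x'" "x' \<in> carrier R" for x x'
    using that KC ideal_star_closed[OF K] by (auto simp: E_def star_add)
  define \<rho> where "\<rho> x = (SOME y. y \<in> carrier R \<and> E y x)" for x
  have rho: "\<rho> x \<in> carrier R" "E (\<rho> x) x" if "x \<in> carrier R" for x
    using someI[of "\<lambda>y. y \<in> carrier R \<and> E y x" x] refl[OF that] that by (auto simp: \<rho>_def)
  have rho_eq: "\<rho> x = \<rho> y \<longleftrightarrow> E x y" if "x \<in> carrier R" "y \<in> carrier R" for x y
  proof
    assume "\<rho> x = \<rho> y"
    then show "E x y"
      using trans[OF sym[OF rho(2)[OF that(1)] that(1)] _ that(2)] rho(2)[OF that(2)] by simp
  next
    assume "E x y"
    then have "E z x \<longleftrightarrow> E z y" if "z \<in> carrier R" for z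
      using trans[of z x y] trans[of z y x] sym[of x y] \<open>x \<in> carrier R\<close> \<open>y \<in> carrier R\<close> by blast
    then have "(\<lambda>z. z \<in> carrier R \<and> E z x) = (\<lambda>z. z \<in> carrier R \<and> E z y)" by blast
    then show "\<rho> x = \<rho> y" unfolding \<rho>_def by simp
  qed
  define Q :: "'a star_ring" where "Q = \<lparr>carrier = \<rho> ` carrier R,
    monoid.mult = (\<lambda>a b. \<rho> (a \<otimes> b)), one = \<rho> \<one>, ring.zero = \<rho> \<zero>,
    ring.add = (\<lambda>a b. \<rho> (a \<oplus> b)), star = (\<lambda>a. \<rho> (star R a))\<rparr>"
  have "\<rho> (\<rho> a \<otimes> \<rho> b) = \<rho> (a \<otimes> b)" "\<rho> (\<rho> a \<oplus> \<rho> b) = \<rho> (a \<oplus> b)"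
    if "a \<in> carrier R" "b \<in> carrier R" for a b
    using mult[OF rho(2) rho(2) that] add[OF rho(2) rho(2) that] rho(1) rho_eq that
    by (simp_all add: mult_closed)
  moreover have "\<rho> (star R (\<rho> a)) = \<rho> (star R a)" if "a \<in> carrier R" for a
    using star[OF rho(2) that] rho(1) rho_eq that by (simp add: star_closed)
  ultimately have hom: "\<rho> \<in> star_ring_hom u R Q"
    by (intro star_ring_homI) (simp_all add: Q_def)
  have "star_regular u Q"
    by (rule star_regular_image[OF _ hom]) (auto simp: Q_def star_regular_iff star_regular_ring_axioms)
  moreover have "\<rho> x = \<zero>\<^bsub>Q\<^esub> \<longleftrightarrow> x \<in> K" if "x \<in> carrier R" for x
    using that rho_eq[of x \<zero>] KC by (auto simp: Q_def E_def)
  moreover have "\<rho> ` carrier R = carrier Q" by (simp add: Q_def)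
  ultimately show ?thesis using hom by blast
qed

section \<open>Ultrafilters\<close>

lemma exists_ultrafilter_below:
  fixes F :: "'i filter"
  assumes "F \<noteq> bot"
  shows "\<exists>U\<le>F. U \<noteq> bot \<and> (\<forall>P. eventually P U \<or> eventually (\<lambda>i. \<not> P i) U)"
proof -
  define A where "A = {G. G \<le> F \<and> G \<noteq> bot}"
  let ?R = "relation_of (\<lambda>G H. H \<le> G) A"
  have "\<exists>U\<in>A. \<forall>G\<in>A. G \<le> U \<longrightarrow> G = U"
  proof (rule predicate_Zorn)
    show "partial_order_on A ?R"
      by (rule partial_order_on_relation_ofI) auto
    fix C assume C: "C \<in> Chains ?R"
    then have sub: "C \<subseteq> A" and chain: "\<And>G H. G \<in> C \<Longrightarrow> H \<in> C \<Longrightarrow> G \<le> H \<or> H \<le> G"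
      unfolding Chains_def relation_of_def by blast+
    show "\<exists>U\<in>A. \<forall>G\<in>C. U \<le> G"
    proof (cases "C = {}")
      case True
      then show ?thesis using assms by (auto simp: A_def)
    next
      case False
      have base: "\<exists>x\<in>C. x \<le> inf G H" if "G \<in> C" "H \<in> C" for G H
        using chain[OF that] that by (metis inf.orderE inf_commute order_refl)
      have "eventually P (Inf C) \<longleftrightarrow> (\<exists>G\<in>C. eventually P G)" for P
        using False base by (intro eventually_Inf_base)
      then have "Inf C \<noteq> bot" using sub unfolding A_def trivial_limit_def by blast
      moreover obtain G where "G \<in> C" "G \<le> F" using False sub by (auto simp: A_def)
      then have "Inf C \<le> F" by (rule Inf_lower2)
      ultimately have "Inf C \<in> A" by (simp add: A_def)
      then show ?thesis using Inf_lower by blast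
    qed
  qed
  then obtain U where "U \<in> A" and max_A: "\<forall>G\<in>A. G \<le> U \<longrightarrow> G = U" by blast
  then have U: "U \<le> F" "U \<noteq> bot" by (simp_all add: A_def)
  have max: "G = U" if "G \<le> U" "G \<noteq> bot" for G
    using max_A that order_trans[OF that(1) U(1)] by (simp add: A_def)
  have "eventually P U" if "\<not> eventually (\<lambda>i. \<not> P i) U" for P
  proof -
    \<comment> \<open>Refining \<open>U\<close> by the set \<open>P\<close> gives a proper filter, so by maximality it changes nothing.\<close>
    have "inf U (principal {i. P i}) \<noteq> bot"
      using that by (auto simp: trivial_limit_def eventually_inf_principal)
    then have "inf U (principal {i. P i}) = U" by (intro max) simp_all
    moreover have "eventually P (inf U (principal {i. P i}))" by (simp add: eventually_inf_principal)
    ultimately show ?thesis by simp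
  qed
  then show ?thesis using U by blast
qed

section \<open>Approximation by families of corner elements\<close>

context subdirectly_irreducible_ring
begin

definition nonzero_projections :: "'a set" where
  "nonzero_projections = {e. is_projection R e \<and> e \<in> J \<and> e \<noteq> \<zero>}"

text \<open>The filters along which the projections of \<open>J\<close> tend to the identity of \<open>J\<close>, pointwise.\<close>

definition exhausting :: "'a filter \<Rightarrow> bool" where
  "exhausting F \<longleftrightarrow> F \<noteq> bot \<and> (\<forall>\<^sub>F e in F. e \<in> nonzero_projections) \<and>
     (\<forall>x\<in>J. \<forall>\<^sub>F e in F. e \<otimes> x = x)"

text \<open>The sets \<open>A x\<close> form a filter base by directedness of the projections in \<open>J\<close>: if \<open>e\<close> fixes a
  projection \<open>p\<close> that fixes \<open>x\<close> and \<open>y\<close>, then \<open>e\<close> fixes \<open>x\<close> and \<open>y\<close>.\<close>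

lemma exhausting_exists: "\<exists>F. exhausting F"
proof -
  define A where "A x = {e \<in> nonzero_projections. e \<otimes> x = x}" for x
  define F where "F = (INF x\<in>J. principal (A x))"
  have "\<exists>z\<in>J. principal (A z) \<le> inf (principal (A x)) (principal (A y))" if xy: "x \<in> J" "y \<in> J" for x y
  proof -
    obtain p where p: "p \<in> J" "p \<otimes> x = x" "p \<otimes> y = y" using J_directed[OF xy] by blast
    have "e \<otimes> x = x \<and> e \<otimes> y = y" if "e \<in> A p" for e
    proof -
      have "e \<in> carrier R" "e \<otimes> p = p"
        using that by (auto simp: A_def nonzero_projections_def is_projection_def)
      then show ?thesis using p xy by (metis J_carrier mult_assoc)
    qed
    then have "A p \<subseteq> A x \<inter> A y" by (auto simp: A_def)
    then show ?thesis using p by auto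
  qed
  then have ev: "eventually P F \<longleftrightarrow> (\<exists>x\<in>J. \<forall>e\<in>A x. P e)" for P
    unfolding F_def using J_D(2) by (subst eventually_INF_base) (auto simp: eventually_principal)
  have "A x \<noteq> {}" if x: "x \<in> J" for x
  proof -
    obtain y where y: "y \<in> J" "y \<noteq> \<zero>" using J_nonzero by blast
    obtain p where p: "p \<in> J" "is_projection R p" "p \<otimes> x = x" "p \<otimes> y = y"
      using J_directed[OF x y(1)] by blast
    then have "p \<noteq> \<zero>" using y zero_mult J_carrier by metis
    then show ?thesis using p by (auto simp: A_def nonzero_projections_def)
  qed
  then have "F \<noteq> bot" unfolding trivial_limit_def ev by blast
  then have "exhausting F"
    unfolding exhausting_def ev using J_D(2) by (auto simp: A_def)
  then show ?thesis ..
qed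

lemma exhausting_mono: "\<lbrakk>exhausting F; U \<le> F; U \<noteq> bot\<rbrakk> \<Longrightarrow> exhausting U"
  by (auto simp: exhausting_def intro: filter_leD)

text \<open>Convergence in the strong operator topology of the action of \<open>R\<close> on the discrete module \<open>J\<close>,
  required of the adjoints as well because the involution need not be continuous for it.\<close>

definition approximates :: "'i filter \<Rightarrow> ('i \<Rightarrow> 'a) \<Rightarrow> 'a \<Rightarrow> bool" where
  "approximates F a r \<longleftrightarrow> r \<in> carrier R \<and> (\<forall>\<^sub>F i in F. a i \<in> carrier R) \<and>
     (\<forall>x\<in>J. \<forall>\<^sub>F i in F. a i \<otimes> x = r \<otimes> x \<and> star R (a i) \<otimes> x = star R r \<otimes> x)"

lemma approximates_limit_closed: "approximates F a r \<Longrightarrow> r \<in> carrier R"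
  and approximates_closed: "approximates F a r \<Longrightarrow> \<forall>\<^sub>F i in F. a i \<in> carrier R"
  and approximatesD: "\<lbrakk>approximates F a r; x \<in> J\<rbrakk> \<Longrightarrow> \<forall>\<^sub>F i in F. a i \<otimes> x = r \<otimes> x"
  and approximatesD_star: "\<lbrakk>approximates F a r; x \<in> J\<rbrakk> \<Longrightarrow> \<forall>\<^sub>F i in F. star R (a i) \<otimes> x = star R r \<otimes> x"
  by (auto simp: approximates_def elim: eventually_mono)

lemma approximates_cong:
  assumes "approximates F a r" "\<forall>\<^sub>F i in F. a i = b i"
  shows "approximates F b r"
proof -
  have "\<forall>\<^sub>F i in F. b i \<in> carrier R"
    using approximates_closed[OF assms(1)] assms(2) by eventually_elim simp
  moreover have "\<forall>\<^sub>F i in F. b i \<otimes> x = r \<otimes> x \<and> star R (b i) \<otimes> x = star R r \<otimes> x" if "x \<in> J" for x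
    using approximatesD[OF assms(1) that] approximatesD_star[OF assms(1) that] assms(2)
    by eventually_elim simp
  ultimately show ?thesis using assms(1) by (auto simp: approximates_def)
qed

lemma approximates_unique:
  assumes "F \<noteq> bot" "approximates F a r" "approximates F a s"
  shows "r = s"
proof (rule J_faithful)
  show "r \<in> carrier R" "s \<in> carrier R" using assms approximates_limit_closed by auto
  fix x assume x: "x \<in> J"
  have "\<forall>\<^sub>F i in F. r \<otimes> x = s \<otimes> x"
    using approximatesD[OF assms(2) x] approximatesD[OF assms(3) x] by eventually_elim simp
  then show "r \<otimes> x = s \<otimes> x" using assms(1) by simp
qed

lemma approximates_add:
  assumes a: "approximates F a r" and b: "approximates F b s"
  shows "approximates F (\<lambda>i. a i \<oplus> b i) (r \<oplus> s)"
proof -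
  note c = approximates_limit_closed[OF a] approximates_limit_closed[OF b]
  have "\<forall>\<^sub>F i in F. a i \<oplus> b i \<in> carrier R"
    using approximates_closed[OF a] approximates_closed[OF b] by eventually_elim simp
  moreover have "\<forall>\<^sub>F i in F. (a i \<oplus> b i) \<otimes> x = (r \<oplus> s) \<otimes> x \<and>
    star R (a i \<oplus> b i) \<otimes> x = star R (r \<oplus> s) \<otimes> x" if x: "x \<in> J" for x
    using approximatesD[OF a x] approximatesD_star[OF a x] approximatesD[OF b x]
      approximatesD_star[OF b x] approximates_closed[OF a] approximates_closed[OF b]
    by eventually_elim (simp add: c J_carrier[OF x] distrib_right star_add star_closed)
  ultimately show ?thesis using c by (auto simp: approximates_def)
qed

lemma approximates_minus:
  assumes a: "approximates F a r"
  shows "approximates F (\<lambda>i. \<ominus> a i) (\<ominus> r)"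
proof -
  note c = approximates_limit_closed[OF a]
  have "\<forall>\<^sub>F i in F. \<ominus> a i \<in> carrier R"
    using approximates_closed[OF a] by eventually_elim simp
  moreover have "\<forall>\<^sub>F i in F. (\<ominus> a i) \<otimes> x = (\<ominus> r) \<otimes> x \<and>
    star R (\<ominus> a i) \<otimes> x = star R (\<ominus> r) \<otimes> x" if x: "x \<in> J" for x
    using approximatesD[OF a x] approximatesD_star[OF a x] approximates_closed[OF a]
    by eventually_elim (simp add: c J_carrier[OF x] minus_mult star_minus star_closed)
  ultimately show ?thesis using c by (auto simp: approximates_def)
qed

lemma approximates_mult:
  assumes a: "approximates F a r" and b: "approximates F b s"
  shows "approximates F (\<lambda>i. a i \<otimes> b i) (r \<otimes> s)"
proof -
  note c = approximates_limit_closed[OF a] approximates_limit_closed[OF b]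
  have "\<forall>\<^sub>F i in F. a i \<otimes> b i \<in> carrier R"
    using approximates_closed[OF a] approximates_closed[OF b] by eventually_elim (simp add: mult_closed)
  moreover have "\<forall>\<^sub>F i in F. (a i \<otimes> b i) \<otimes> x = (r \<otimes> s) \<otimes> x \<and>
    star R (a i \<otimes> b i) \<otimes> x = star R (r \<otimes> s) \<otimes> x" if x: "x \<in> J" for x
    using approximatesD[OF a J_D(6)[OF x c(2)]] approximatesD[OF b x]
      approximatesD_star[OF a x] approximatesD_star[OF b J_D(6)[OF x star_closed[OF c(1)]]]
      approximates_closed[OF a] approximates_closed[OF b]
    by eventually_elim (simp add: c J_carrier[OF x] mult_assoc star_mult star_closed)
  ultimately show ?thesis using c by (auto simp: approximates_def mult_closed)
qed

lemma approximates_star: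
  assumes a: "approximates F a r"
  shows "approximates F (\<lambda>i. star R (a i)) (star R r)"
proof -
  note c = approximates_limit_closed[OF a]
  have "\<forall>\<^sub>F i in F. star R (a i) \<in> carrier R"
    using approximates_closed[OF a] by eventually_elim (simp add: star_closed)
  moreover have "\<forall>\<^sub>F i in F. star R (a i) \<otimes> x = star R r \<otimes> x \<and>
    star R (star R (a i)) \<otimes> x = star R (star R r) \<otimes> x" if x: "x \<in> J" for x
    using approximatesD[OF a x] approximatesD_star[OF a x] approximates_closed[OF a]
    by eventually_elim (simp add: c star_star)
  ultimately show ?thesis using c by (auto simp: approximates_def star_closed)
qed

text \<open>All four test elements of \<open>pseudo_inverse_local\<close> are left multiples of \<open>x\<close> and so lie in
  \<open>J\<close>; each of its equations therefore holds eventually.  Applying this to the adjoints gives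
  the second half of the convergence.\<close>

lemma approximates_pseudo_inverse:
  assumes a: "approximates F a r"
  shows "approximates F (\<lambda>i. pseudo_inverse R (a i)) (pseudo_inverse R r)"
proof -
  have local: "\<forall>\<^sub>F i in F. pseudo_inverse R (b i) \<otimes> x = pseudo_inverse R s \<otimes> x"
    if b: "approximates F b s" and x: "x \<in> J" for b s x
  proof -
    let ?s = "pseudo_inverse R s"
    note s = approximates_limit_closed[OF b]
    note s' = pseudo_inverse_closed[OF s]
    note J = J_D(6)[OF x s'] J_D(6)[OF x mult_closed[OF s s']]
      J_D(6)[OF x mult_closed[OF star_closed[OF s'] s']]
    show ?thesis
      using approximatesD_star[OF b x] approximatesD_star[OF b J(2)] approximatesD[OF b J(1)]
        approximatesD_star[OF b J(3)] approximates_closed[OF b]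
      by eventually_elim (rule pseudo_inverse_local[OF _ s J_carrier[OF x]])
  qed
  note c = approximates_limit_closed[OF a]
  have "\<forall>\<^sub>F i in F. pseudo_inverse R (a i) \<in> carrier R"
    using approximates_closed[OF a] by eventually_elim (rule pseudo_inverse_closed)
  moreover have "\<forall>\<^sub>F i in F. pseudo_inverse R (a i) \<otimes> x = pseudo_inverse R r \<otimes> x \<and>
    star R (pseudo_inverse R (a i)) \<otimes> x = star R (pseudo_inverse R r) \<otimes> x" if x: "x \<in> J" for x
    using local[OF a x] local[OF approximates_star[OF a] x] approximates_closed[OF a]
    by eventually_elim (simp add: c pseudo_inverse_star)
  ultimately show ?thesis using c by (auto simp: approximates_def pseudo_inverse_closed)
qed

lemma approximates_zero: "approximates F (\<lambda>i. \<zero>) \<zero>"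
  by (simp add: approximates_def)

lemma exhausting_projection: "exhausting F \<Longrightarrow> \<forall>\<^sub>F e in F. is_projection R e"
  by (auto simp: exhausting_def nonzero_projections_def elim: eventually_mono)

lemma approximates_one:
  assumes F: "exhausting F" and u
  shows "approximates F (\<lambda>e. e) \<one>"
proof -
  have "star R \<one> = \<one>"
    using unit_closed[OF \<open>u\<close>] unit_left[OF \<open>u\<close>] unit_right[OF \<open>u\<close>] by (metis star_closed star_mult star_star)
  moreover have "\<forall>\<^sub>F e in F. e \<in> carrier R"
    using exhausting_projection[OF F] by eventually_elim (simp add: is_projection_def)
  moreover have "\<forall>\<^sub>F e in F. e \<otimes> x = x \<and> star R e \<otimes> x = x" if x: "x \<in> J" for x
  proof -
    have "\<forall>\<^sub>F e in F. e \<otimes> x = x" using F x by (simp add: exhausting_def)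
    then show ?thesis
      using exhausting_projection[OF F] by eventually_elim (simp add: projectionD)
  qed
  ultimately show ?thesis
    using \<open>u\<close> by (auto simp: approximates_def unit_closed unit_left J_carrier)
qed

lemma approximates_compression:
  assumes F: "exhausting F" and r: "r \<in> carrier R"
  shows "approximates F (\<lambda>e. e \<otimes> r \<otimes> e) r"
proof -
  have "\<forall>\<^sub>F e in F. e \<otimes> r \<otimes> e \<in> carrier R"
    using exhausting_projection[OF F] by eventually_elim (simp add: projectionD r mult_closed)
  moreover have "\<forall>\<^sub>F e in F. e \<otimes> r \<otimes> e \<otimes> x = r \<otimes> x \<and> star R (e \<otimes> r \<otimes> e) \<otimes> x = star R r \<otimes> x"
    if x: "x \<in> J" for x
  proof -
    have ev: "\<forall>\<^sub>F e in F. e \<otimes> y = y" if "y \<in> J" for y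
      using F that by (simp add: exhausting_def)
    show ?thesis
      using exhausting_projection[OF F] ev[OF x] ev[OF J_D(6)[OF x r]]
        ev[OF J_D(6)[OF x star_closed[OF r]]]
      by eventually_elim
        (simp add: projectionD r J_carrier[OF x] mult_closed star_closed star_mult mult_assoc)
  qed
  ultimately show ?thesis using r by (auto simp: approximates_def)
qed

lemma compression_in_corner: "r \<in> carrier R \<Longrightarrow> e \<otimes> r \<otimes> e \<in> carrier (corner R e)"
  by (auto simp: corner_def)

text \<open>The operations of the corner are those of \<open>R\<close> on elements of the corner, except for the
  unit, which is \<open>e\<close> and approximates the unit of \<open>R\<close>.\<close>

lemma approximates_interp:
  assumes F: "exhausting F" and t: "in_signature u t" and v: "\<And>n. v n \<in> carrier R"
  shows "approximates F (\<lambda>e. interp (corner R e) (\<lambda>n. e \<otimes> v n \<otimes> e) t) (interp R v t)"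
  using t
proof (induction t)
  case (Neg t)
  have "\<forall>\<^sub>F e in F. \<ominus> interp (corner R e) (\<lambda>n. e \<otimes> v n \<otimes> e) t =
      \<ominus>\<^bsub>corner R e\<^esub> interp (corner R e) (\<lambda>n. e \<otimes> v n \<otimes> e) t"
    using exhausting_projection[OF F]
    by eventually_elim (use Neg.prems v in
      \<open>simp add: corner_operations interp_closed[OF star_regular_corner] compression_in_corner\<close>)
  from approximates_cong[OF approximates_minus[OF Neg.IH] this] show ?case
    using Neg.prems by simp
next
  case (PInv t)
  have "\<forall>\<^sub>F e in F. pseudo_inverse R (interp (corner R e) (\<lambda>n. e \<otimes> v n \<otimes> e) t) =
      pseudo_inverse (corner R e) (interp (corner R e) (\<lambda>n. e \<otimes> v n \<otimes> e) t)"
    using exhausting_projection[OF F]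
    by eventually_elim (use PInv.prems v in
      \<open>simp add: corner_operations interp_closed[OF star_regular_corner] compression_in_corner\<close>)
  from approximates_cong[OF approximates_pseudo_inverse[OF PInv.IH] this] show ?case
    using PInv.prems by simp
qed (use F v in \<open>auto intro: approximates_compression approximates_zero approximates_one
  approximates_add approximates_mult approximates_star\<close>)

text \<open>Both sides of the identity are limits of their values in the corners, where they agree.\<close>

lemma satisfies_if_corners_satisfy:
  assumes sig: "in_signature u s" "in_signature u t"
    and corners: "\<And>e. e \<in> nonzero_projections \<Longrightarrow> satisfies (corner R e) s t"
  shows "satisfies R s t"
  unfolding satisfies_def
proof (intro allI impI)
  fix v :: "nat \<Rightarrow> 'a" assume v: "\<forall>n. v n \<in> carrier R"
  obtain F where F: "exhausting F" using exhausting_exists ..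
  then have "\<forall>\<^sub>F e in F. e \<in> nonzero_projections" by (simp add: exhausting_def)
  then have "\<forall>\<^sub>F e in F. interp (corner R e) (\<lambda>n. e \<otimes> v n \<otimes> e) s =
      interp (corner R e) (\<lambda>n. e \<otimes> v n \<otimes> e) t"
    by eventually_elim (use corners v compression_in_corner in \<open>simp add: satisfies_def\<close>)
  then have "approximates F (\<lambda>e. interp (corner R e) (\<lambda>n. e \<otimes> v n \<otimes> e) t) (interp R v s)"
    using approximates_cong[OF approximates_interp[OF F sig(1)]] v by simp
  then show "interp R v s = interp R v t"
    using approximates_unique[OF _ _ approximates_interp[OF F sig(2)]] F v by (simp add: exhausting_def)
qed

end

section \<open>Products and ultraproducts\<close>

definition product :: "'i set \<Rightarrow> ('i \<Rightarrow> ('a, 'm) star_ring_scheme) \<Rightarrow> ('i \<Rightarrow> 'a) star_ring" where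
  "product I A = \<lparr>
     carrier = (\<Pi>\<^sub>E i\<in>I. carrier (A i)),
     monoid.mult = (\<lambda>f g. \<lambda>i\<in>I. f i \<otimes>\<^bsub>A i\<^esub> g i),
     one = (\<lambda>i\<in>I. \<one>\<^bsub>A i\<^esub>),
     ring.zero = (\<lambda>i\<in>I. \<zero>\<^bsub>A i\<^esub>),
     ring.add = (\<lambda>f g. \<lambda>i\<in>I. f i \<oplus>\<^bsub>A i\<^esub> g i),
     star = (\<lambda>f. \<lambda>i\<in>I. star (A i) (f i))\<rparr>"

lemma star_ring_product:
  assumes "\<And>i. i \<in> I \<Longrightarrow> star_ring u (A i)"
  shows "star_ring u (product I A)"
proof (rule star_ringI)
  have grp: "abelian_group (A i)" if "i \<in> I" for i
    using assms[OF that] by (simp add: star_ring_def)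
  note ag = abelian_groupE[OF grp]
  show "abelian_group (product I A)"
  proof (rule abelian_groupI)
    fix f assume f: "f \<in> carrier (product I A)"
    define g where "g = (\<lambda>i\<in>I. \<ominus>\<^bsub>A i\<^esub> f i)"
    have "g \<in> carrier (product I A)" "g \<oplus>\<^bsub>product I A\<^esub> f = \<zero>\<^bsub>product I A\<^esub>"
      using f by (auto simp: g_def product_def fun_eq_iff PiE_iff
          abelian_group.a_inv_closed[OF grp] abelian_group.l_neg[OF grp])
    then show "\<exists>g\<in>carrier (product I A). g \<oplus>\<^bsub>product I A\<^esub> f = \<zero>\<^bsub>product I A\<^esub>" by blast
  next
    fix f g assume "f \<in> carrier (product I A)" "g \<in> carrier (product I A)"
    then show "f \<oplus>\<^bsub>product I A\<^esub> g = g \<oplus>\<^bsub>product I A\<^esub> f"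
      by (auto simp: product_def PiE_iff ag(4) fun_eq_iff)
  qed (auto simp: product_def PiE_iff ag(1,2,3,5) fun_eq_iff extensional_def)
qed (auto simp: product_def PiE_iff extensional_def fun_eq_iff
  star_ring.mult_closed[OF assms] star_ring.mult_assoc[OF assms] star_ring.distrib_left[OF assms]
  star_ring.distrib_right[OF assms] star_ring.unit_closed[OF assms] star_ring.unit_left[OF assms]
  star_ring.unit_right[OF assms] star_ring.star_closed[OF assms] star_ring.star_add[OF assms]
  star_ring.star_mult[OF assms] star_ring.star_star[OF assms])

lemma proper_product:
  assumes "\<And>i. i \<in> I \<Longrightarrow> proper (A i)"
  shows "proper (product I A)"
  using assms by (force simp: proper_def product_def PiE_iff extensional_def fun_eq_iff)

context
  fixes I :: "'i set" and A :: "'i \<Rightarrow> ('a, 'm) star_ring_scheme" and U :: "'i filter"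
  assumes ev_I: "\<forall>\<^sub>F i in U. i \<in> I"
begin

lemma ultra_class_eq:
  assumes "f \<in> (\<Pi>\<^sub>E i\<in>I. carrier (A i))"
  shows "ultra_class I A U f = {g \<in> (\<Pi>\<^sub>E i\<in>I. carrier (A i)). \<forall>\<^sub>F i in U. f i = g i}"
  using assms by (auto simp: ultra_class_def ultra_rel_def PiE_restrict)

lemma ultra_class_eq_iff:
  assumes "f \<in> (\<Pi>\<^sub>E i\<in>I. carrier (A i))" "g \<in> (\<Pi>\<^sub>E i\<in>I. carrier (A i))"
  shows "ultra_class I A U f = ultra_class I A U g \<longleftrightarrow> (\<forall>\<^sub>F i in U. f i = g i)"
proof
  assume "ultra_class I A U f = ultra_class I A U g"
  then have "g \<in> ultra_class I A U f" using ultra_class_eq assms by simp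
  then show "\<forall>\<^sub>F i in U. f i = g i" using ultra_class_eq assms by simp
next
  assume fg: "\<forall>\<^sub>F i in U. f i = g i"
  have "(\<forall>\<^sub>F i in U. f i = h i) \<longleftrightarrow> (\<forall>\<^sub>F i in U. g i = h i)" for h
    using fg by (intro eventually_cong[OF fg]) simp
  then show "ultra_class I A U f = ultra_class I A U g" by (simp add: ultra_class_eq assms)
qed

lemma ultra_class_restrict: "ultra_class I A U (restrict f I) = ultra_class I A U f"
  by (simp add: ultra_class_def)

text \<open>The operations of the ultraproduct are unions over all representatives; the next two lemmas
  say that a single representative suffices.\<close>

lemma ultra_class_lift1:
  assumes f: "f \<in> (\<Pi>\<^sub>E i\<in>I. carrier (A i))"
    and closed: "\<And>i a. i \<in> I \<Longrightarrow> a \<in> carrier (A i) \<Longrightarrow> p i a \<in> carrier (A i)"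
  shows "(\<Union>f'\<in>ultra_class I A U f. ultra_class I A U (\<lambda>i. p i (f' i))) =
    ultra_class I A U (\<lambda>i\<in>I. p i (f i))"
proof -
  have "ultra_class I A U (\<lambda>i. p i (f' i)) = ultra_class I A U (\<lambda>i\<in>I. p i (f i))"
    if "f' \<in> ultra_class I A U f" for f'
  proof -
    have f': "f' \<in> (\<Pi>\<^sub>E i\<in>I. carrier (A i))" "\<forall>\<^sub>F i in U. f i = f' i"
      using that ultra_class_eq[OF f] by auto
    have "\<forall>\<^sub>F i in U. (\<lambda>i\<in>I. p i (f' i)) i = (\<lambda>i\<in>I. p i (f i)) i"
      using f'(2) ev_I by eventually_elim simp
    then have "ultra_class I A U (\<lambda>i\<in>I. p i (f' i)) = ultra_class I A U (\<lambda>i\<in>I. p i (f i))"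
      using f f' closed by (subst ultra_class_eq_iff) (auto simp: PiE_iff)
    then show ?thesis by (simp add: ultra_class_restrict)
  qed
  moreover have "f \<in> ultra_class I A U f" using ultra_class_eq[OF f] f by simp
  ultimately show ?thesis by blast
qed

lemma ultra_class_lift2:
  assumes f: "f \<in> (\<Pi>\<^sub>E i\<in>I. carrier (A i))" and g: "g \<in> (\<Pi>\<^sub>E i\<in>I. carrier (A i))"
    and closed: "\<And>i a b. i \<in> I \<Longrightarrow> a \<in> carrier (A i) \<Longrightarrow> b \<in> carrier (A i) \<Longrightarrow> p i a b \<in> carrier (A i)"
  shows "(\<Union>f'\<in>ultra_class I A U f. \<Union>g'\<in>ultra_class I A U g. ultra_class I A U (\<lambda>i. p i (f' i) (g' i))) =
    ultra_class I A U (\<lambda>i\<in>I. p i (f i) (g i))"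
proof -
  have "ultra_class I A U (\<lambda>i. p i (f' i) (g' i)) = ultra_class I A U (\<lambda>i\<in>I. p i (f i) (g i))"
    if "f' \<in> ultra_class I A U f" "g' \<in> ultra_class I A U g" for f' g'
  proof -
    have f': "f' \<in> (\<Pi>\<^sub>E i\<in>I. carrier (A i))" "\<forall>\<^sub>F i in U. f i = f' i"
      and g': "g' \<in> (\<Pi>\<^sub>E i\<in>I. carrier (A i))" "\<forall>\<^sub>F i in U. g i = g' i"
      using that ultra_class_eq[OF f] ultra_class_eq[OF g] by auto
    have "\<forall>\<^sub>F i in U. (\<lambda>i\<in>I. p i (f' i) (g' i)) i = (\<lambda>i\<in>I. p i (f i) (g i)) i"
      using f'(2) g'(2) ev_I by eventually_elim simp
    then have "ultra_class I A U (\<lambda>i\<in>I. p i (f' i) (g' i)) = ultra_class I A U (\<lambda>i\<in>I. p i (f i) (g i))"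
      using f f' g g' closed by (subst ultra_class_eq_iff) (auto simp: PiE_iff)
    then show ?thesis by (simp add: ultra_class_restrict)
  qed
  moreover have "f \<in> ultra_class I A U f" "g \<in> ultra_class I A U g"
    using ultra_class_eq f g by simp_all
  ultimately show ?thesis by blast
qed

lemma ultra_class_hom:
  assumes "\<And>i. i \<in> I \<Longrightarrow> star_ring u (A i)"
  shows "ultra_class I A U \<in> star_ring_hom u (product I A) (ultraproduct I A U)"
    and "ultra_class I A U ` carrier (product I A) = carrier (ultraproduct I A U)"
    and "ultra_class I A U \<zero>\<^bsub>product I A\<^esub> = \<zero>\<^bsub>ultraproduct I A U\<^esub>"
proof -
  have grp: "abelian_group (A i)" if "i \<in> I" for i
    using assms[OF that] by (simp add: star_ring_def)
  show onto: "ultra_class I A U ` carrier (product I A) = carrier (ultraproduct I A U)"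
    by (auto simp: product_def ultraproduct_def quotient_def ultra_class_def PiE_restrict)
  show "ultra_class I A U \<zero>\<^bsub>product I A\<^esub> = \<zero>\<^bsub>ultraproduct I A U\<^esub>"
    by (simp add: product_def ultraproduct_def ultra_class_restrict)
  show "ultra_class I A U \<in> star_ring_hom u (product I A) (ultraproduct I A U)"
  proof (rule star_ring_homI)
    show "ultra_class I A U f \<in> carrier (ultraproduct I A U)" if "f \<in> carrier (product I A)" for f
      using that onto by blast
  qed (simp_all add: product_def ultraproduct_def
      ultra_class_lift1[where p = "\<lambda>i. star (A i)"]
      ultra_class_lift2[where p = "\<lambda>i. mult (A i)"] ultra_class_lift2[where p = "\<lambda>i. add (A i)"]
      ultra_class_restrict star_ring.mult_closed[OF assms] star_ring.star_closed[OF assms]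
      abelian_groupE(1)[OF grp])
qed

end

section \<open>A subdirectly irreducible ring as an image of convergent families\<close>

lemma star_subring_image:
  assumes "star_ring u R" "star_ring u Q" "h \<in> star_ring_hom u R Q" "star_subring u S R"
  shows "star_subring u (h ` S) Q"
proof -
  interpret R: star_ring u R by fact
  interpret Q: star_ring u Q by fact
  note h = star_ring_homD[OF assms(3)] star_ring_hom_zero[OF assms(1-3)] star_ring_hom_minus[OF assms(1-3)]
  have S: "S \<subseteq> carrier R" "\<zero>\<^bsub>R\<^esub> \<in> S" "\<And>x y. x \<in> S \<Longrightarrow> y \<in> S \<Longrightarrow> x \<oplus>\<^bsub>R\<^esub> y \<in> S"
    "\<And>x. x \<in> S \<Longrightarrow> \<ominus>\<^bsub>R\<^esub> x \<in> S" "\<And>x y. x \<in> S \<Longrightarrow> y \<in> S \<Longrightarrow> x \<otimes>\<^bsub>R\<^esub> y \<in> S"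
    "\<And>x. x \<in> S \<Longrightarrow> star R x \<in> S" "u \<Longrightarrow> \<one>\<^bsub>R\<^esub> \<in> S"
    using assms(4) by (auto simp: star_subring_def R.additive_subgroup_iff)
  have c: "\<And>x. x \<in> S \<Longrightarrow> x \<in> carrier R" using S(1) by auto
  show ?thesis
    unfolding star_subring_def Q.additive_subgroup_iff
    using S(2-7) by (auto simp: c h(1) h(2-7)[symmetric] simp del: image_eqI intro!: imageI)
qed

context subdirectly_irreducible_ring
begin

text \<open>The subring of the ultraproduct consists of the classes of the convergent families, and the
  homomorphism onto \<open>R\<close> takes a class to its limit.  All algebraic properties are established for
  the convergent families in the product and pushed forward to their classes.\<close>

lemma image_of_ultraproduct_subring:
  defines "I \<equiv> nonzero_projections"
  shows "\<exists>U S h. ultrafilter_on I U \<and>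
    star_subring u S (ultraproduct I (corner R) U) \<and>
    star_regular u ((ultraproduct I (corner R) U)\<lparr>carrier := S\<rparr>) \<and>
    h \<in> star_ring_hom u ((ultraproduct I (corner R) U)\<lparr>carrier := S\<rparr>) R \<and>
    h ` S = carrier R"
proof -
  obtain F where F: "exhausting F" using exhausting_exists ..
  then obtain U where UF: "U \<le> F" and U: "U \<noteq> bot" "\<And>P. eventually P U \<or> eventually (\<lambda>i. \<not> P i) U"
    using exists_ultrafilter_below[of F] by (auto simp: exhausting_def)
  have ex: "exhausting U" using exhausting_mono[OF F UF U(1)] .
  then have ev_I: "\<forall>\<^sub>F i in U. i \<in> I" by (simp add: exhausting_def I_def)
  have uf: "ultrafilter_on I U" using U ev_I by (simp add: ultrafilter_on_def)
  have proj: "is_projection R e" if "e \<in> I" for e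
    using that by (simp add: I_def nonzero_projections_def)
  have cor: "star_regular u (corner R e)" if "e \<in> I" for e
    using star_regular_corner[OF proj[OF that]] .
  then have corR: "star_ring u (corner R e)" "proper (corner R e)" if "e \<in> I" for e
    using that by (auto simp: star_regular_def)
  let ?P = "product I (corner R)" and ?Q = "ultraproduct I (corner R) U"
    and ?c = "ultra_class I (corner R) U"
  have P: "star_ring u ?P" "proper ?P"
    using star_ring_product proper_product corR by blast+
  interpret P: star_ring u ?P by fact
  have hom: "?c \<in> star_ring_hom u ?P ?Q" "?c ` carrier ?P = carrier ?Q" "?c \<zero>\<^bsub>?P\<^esub> = \<zero>\<^bsub>?Q\<^esub>"
    using ultra_class_hom[OF ev_I, where A = "corner R" and u = u] corR(1) by blast+
  have Q: "star_ring u ?Q"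
    using star_ring_image[OF P(1) hom(1)] hom(2,3) by simp
  have PC: "f \<in> carrier ?P \<longleftrightarrow> f \<in> (\<Pi>\<^sub>E i\<in>I. carrier (corner R i))" for f
    by (simp add: product_def)
  define T where "T = {f \<in> carrier ?P. \<exists>r. approximates U f r}"
  have restr: "approximates U (\<lambda>i\<in>I. f i) r" if "approximates U f r" for f r
    by (rule approximates_cong[OF that]) (use ev_I in eventually_elim, simp)
  have minus: "\<ominus>\<^bsub>?P\<^esub> f = (\<lambda>i\<in>I. \<ominus> f i)" if f: "f \<in> carrier ?P" for f
  proof (rule P.minus_equality)
    have "\<ominus> f i = \<ominus>\<^bsub>corner R i\<^esub> f i" if "i \<in> I" for i
      using corner_operations(1)[OF proj[OF that]] f that by (auto simp: PC PiE_iff)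
    moreover have "\<ominus>\<^bsub>corner R i\<^esub> f i \<in> carrier (corner R i)"
      "\<ominus>\<^bsub>corner R i\<^esub> f i \<oplus>\<^bsub>corner R i\<^esub> f i = \<zero>\<^bsub>corner R i\<^esub>" if "i \<in> I" for i
    proof -
      interpret C: star_ring u "corner R i" using corR(1)[OF that] .
      have "f i \<in> carrier (corner R i)" using f that by (auto simp: PC PiE_iff)
      then show "\<ominus>\<^bsub>corner R i\<^esub> f i \<in> carrier (corner R i)"
        "\<ominus>\<^bsub>corner R i\<^esub> f i \<oplus>\<^bsub>corner R i\<^esub> f i = \<zero>\<^bsub>corner R i\<^esub>"
        using C.a_inv_closed C.l_neg by blast+
    qed
    ultimately show "(\<lambda>i\<in>I. \<ominus> f i) \<in> carrier ?P" "(\<lambda>i\<in>I. \<ominus> f i) \<oplus>\<^bsub>?P\<^esub> f = \<zero>\<^bsub>?P\<^esub>"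
      by (auto simp: product_def fun_eq_iff)
  qed (rule f)
  have lim: "approximates U (f \<oplus>\<^bsub>?P\<^esub> g) (r \<oplus> s)" "approximates U (f \<otimes>\<^bsub>?P\<^esub> g) (r \<otimes> s)"
    if "approximates U f r" "approximates U g s" for f g r s
    using approximates_add[OF that] approximates_mult[OF that]
    by (auto simp: product_def intro: restr)
  have lim_star: "approximates U (star ?P f) (star R r)" if "approximates U f r" for f r
    using approximates_star[OF that] by (auto simp: product_def intro: restr)
  have lim_one: "approximates U \<one>\<^bsub>?P\<^esub> \<one>" if u
    using approximates_one[OF ex that] by (auto simp: product_def intro: restr)
  have TP: "\<And>f. f \<in> T \<Longrightarrow> f \<in> carrier ?P" by (simp add: T_def)
  have T: "star_subring u T ?P"
    unfolding star_subring_def P.additive_subgroup_iff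
  proof (intro conjI ballI impI subsetI)
    show "\<zero>\<^bsub>?P\<^esub> \<in> T"
      using restr[OF approximates_zero] P.zero_closed by (auto simp: T_def) (auto simp: product_def)
    show "\<ominus>\<^bsub>?P\<^esub> f \<in> T" if f: "f \<in> T" for f
      using f P.a_inv_closed[OF TP[OF f]] unfolding T_def
      by (auto simp: minus intro: restr approximates_minus)
  qed (auto simp: T_def P.closed_simps intro: lim lim_star lim_one)
  \<comment> \<open>Pseudo-inverses taken componentwise again form a convergent family.\<close>
  have T_inner: "\<exists>g\<in>T. f \<otimes>\<^bsub>?P\<^esub> g \<otimes>\<^bsub>?P\<^esub> f = f" if f: "f \<in> T" for f
  proof -
    define g where "g = (\<lambda>i\<in>I. pseudo_inverse R (f i))"
    have fi: "f i \<in> carrier (corner R i)" "f i \<in> carrier R" if "i \<in> I" for i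
      using TP[OF f] that corner_carrier[OF proj[OF that]] by (auto simp: PC PiE_iff)
    have "pseudo_inverse R (f i) \<in> carrier (corner R i)" if "i \<in> I" for i
    proof -
      interpret C: star_regular_ring u "corner R i" using cor[OF that] by (simp add: star_regular_iff)
      show ?thesis
        using C.pseudo_inverse_closed[OF fi(1)[OF that]] corner_operations(2)[OF proj fi(1)] that by simp
    qed
    then have "g \<in> carrier ?P" by (simp add: g_def PC)
    moreover have "\<exists>r. approximates U g r"
      using f unfolding T_def g_def by (auto intro: restr approximates_pseudo_inverse)
    moreover have "f \<otimes>\<^bsub>?P\<^esub> g \<otimes>\<^bsub>?P\<^esub> f = f"
      using TP[OF f] fi pseudo_inverse_inner
      by (auto simp: product_def g_def fun_eq_iff PiE_iff extensional_def)
    ultimately show ?thesis by (auto simp: T_def)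
  qed
  have RT: "star_regular u (?P\<lparr>carrier := T\<rparr>)"
    by (rule star_regular_subring[OF P T T_inner])
  define S where "S = ?c ` T"
  have homT: "?c \<in> star_ring_hom u (?P\<lparr>carrier := T\<rparr>) (?Q\<lparr>carrier := S\<rparr>)"
    using star_ring_homD[OF hom(1)] TP by (intro star_ring_homI) (auto simp: S_def)
  have S: "star_subring u S ?Q"
    unfolding S_def by (rule star_subring_image[OF P(1) Q hom(1) T])
  have RS: "star_regular u (?Q\<lparr>carrier := S\<rparr>)"
    by (rule star_regular_image[OF RT homT]) (auto simp: S_def hom(3))
  define h where "h X = (THE r. \<exists>f\<in>T. X = ?c f \<and> approximates U f r)" for X
  \<comment> \<open>Equivalent families agree eventually, so they have the same limit.\<close>
  have h_eq: "h (?c f) = r" if f: "f \<in> T" "approximates U f r" for f r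
    unfolding h_def
  proof (rule the_equality)
    show "\<exists>g\<in>T. ?c f = ?c g \<and> approximates U g r" using f by blast
    fix s assume "\<exists>g\<in>T. ?c f = ?c g \<and> approximates U g s"
    then obtain g where g: "g \<in> T" "?c f = ?c g" "approximates U g s" by blast
    then have "\<forall>\<^sub>F i in U. f i = g i"
      using ultra_class_eq_iff[OF ev_I, where A = "corner R" and f = f and g = g] TP[OF f(1)] TP[OF g(1)]
      by (simp add: PC)
    from approximates_cong[OF f(2) this] show "s = r"
      using approximates_unique[OF U(1)] g(3) by blast
  qed
  have SE: "\<exists>f r. f \<in> T \<and> approximates U f r \<and> X = ?c f" if "X \<in> S" for X
    using that by (auto simp: S_def T_def)
  note c = star_ring_homD[OF hom(1)]
  have T_closed: "\<And>f g. f \<in> T \<Longrightarrow> g \<in> T \<Longrightarrow> f \<oplus>\<^bsub>?P\<^esub> g \<in> T"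
    "\<And>f g. f \<in> T \<Longrightarrow> g \<in> T \<Longrightarrow> f \<otimes>\<^bsub>?P\<^esub> g \<in> T" "\<And>f. f \<in> T \<Longrightarrow> star ?P f \<in> T"
    "u \<Longrightarrow> \<one>\<^bsub>?P\<^esub> \<in> T"
    using T unfolding star_subring_def P.additive_subgroup_iff by blast+
  have "h \<in> star_ring_hom u (?Q\<lparr>carrier := S\<rparr>) R"
  proof (rule star_ring_homI, goal_cases)
    case (1 X)
    then show ?case using SE[of X] h_eq approximates_limit_closed by force
  next
    case (2 X Y)
    then obtain f g r s where "f \<in> T" "approximates U f r" "X = ?c f" "g \<in> T" "approximates U g s" "Y = ?c g"
      using SE[of X] SE[of Y] by auto
    then show ?case
      using h_eq[OF T_closed(2) lim(2), of f g r s] h_eq c(2)[of f g] TP by simp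
  next
    case (3 X Y)
    then obtain f g r s where "f \<in> T" "approximates U f r" "X = ?c f" "g \<in> T" "approximates U g s" "Y = ?c g"
      using SE[of X] SE[of Y] by auto
    then show ?case
      using h_eq[OF T_closed(1) lim(1), of f g r s] h_eq c(3)[of f g] TP by simp
  next
    case (4 X)
    then obtain f r where "f \<in> T" "approximates U f r" "X = ?c f"
      using SE[of X] by auto
    then show ?case
      using h_eq[OF T_closed(3) lim_star, of f r] h_eq c(4)[of f] TP by simp
  next
    case 5
    then show ?case using h_eq[OF T_closed(4) lim_one] c(5) by simp
  qed
  moreover have "h ` S = carrier R"
  proof (intro equalityI subsetI)
    fix r assume "r \<in> h ` S"
    then show "r \<in> carrier R" using SE h_eq approximates_limit_closed by force
  next
    fix r assume r: "r \<in> carrier R"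
    let ?f = "\<lambda>e\<in>I. e \<otimes> r \<otimes> e"
    have ap: "approximates U ?f r" by (rule restr[OF approximates_compression[OF ex r]])
    moreover have "?f \<in> carrier ?P" using r by (simp add: PC compression_in_corner)
    ultimately have "?f \<in> T" by (auto simp: T_def)
    then show "r \<in> h ` S" using h_eq[OF _ ap] by (auto simp: S_def intro!: image_eqI)
  qed
  ultimately show ?thesis using uf S RS by blast
qed

end

section \<open>Generation by simple members\<close>

lemma exists_maximal_ideal_avoiding:
  assumes "star_ring u R" "d \<in> carrier R" "d \<noteq> \<zero>\<^bsub>R\<^esub>"
  shows "\<exists>K. two_sided_ideal K R \<and> d \<notin> K \<and> (\<forall>L. two_sided_ideal L R \<and> d \<notin> L \<and> K \<subseteq> L \<longrightarrow> L = K)"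
proof -
  interpret star_ring u R by fact
  define \<A> where "\<A> = {K. two_sided_ideal K R \<and> d \<notin> K}"
  have "\<exists>M\<in>\<A>. \<forall>X\<in>\<A>. M \<subseteq> X \<longrightarrow> X = M"
  proof (rule subset_Zorn_nonempty)
    have "two_sided_ideal {\<zero>\<^bsub>R\<^esub>} R"
      by (rule two_sided_idealI) (simp_all add: zero_mult mult_zero)
    then show "\<A> \<noteq> {}" using assms(3) by (auto simp: \<A>_def)
    fix C assume C: "C \<noteq> {}" "subset.chain \<A> C"
    have sub: "two_sided_ideal K R" "d \<notin> K" if "K \<in> C" for K
      using that C(2) by (auto simp: subset.chain_def \<A>_def)
    note D = two_sided_idealD[OF sub(1)]
    have "two_sided_ideal (\<Union>C) R"
    proof (rule two_sided_idealI)
      show "\<Union>C \<subseteq> carrier R" "\<zero>\<^bsub>R\<^esub> \<in> \<Union>C" using D(1,2) C(1) by blast+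
      fix x assume "x \<in> \<Union>C"
      then obtain K where K: "K \<in> C" "x \<in> K" by blast
      show "\<ominus>\<^bsub>R\<^esub> x \<in> \<Union>C" using K D(4) by blast
      show "x \<otimes>\<^bsub>R\<^esub> y \<in> \<Union>C" "y \<otimes>\<^bsub>R\<^esub> x \<in> \<Union>C" if "y \<in> carrier R" for y
        using K D(5,6) that by blast+
      fix y assume "y \<in> \<Union>C"
      then obtain L where L: "L \<in> C" "y \<in> L" by blast
      then have "K \<subseteq> L \<or> L \<subseteq> K" using K C(2) by (auto simp: subset.chain_def)
      then obtain M where "M \<in> C" "x \<in> M" "y \<in> M" using K L by blast
      then show "x \<oplus>\<^bsub>R\<^esub> y \<in> \<Union>C" using D(3) by blast
    qed
    then show "\<Union>C \<in> \<A>" using sub by (auto simp: \<A>_def)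
  qed
  then show ?thesis unfolding \<A>_def by blast
qed

lemma vimage_ideal:
  assumes "star_ring u R" "star_ring u Q" "h \<in> star_ring_hom u R Q" "two_sided_ideal L Q"
  shows "two_sided_ideal {x \<in> carrier R. h x \<in> L} R"
proof -
  interpret R: star_ring u R by fact
  interpret Q: star_ring u Q by fact
  note h = star_ring_homD[OF assms(3)] star_ring_hom_zero[OF assms(1-3)]
    star_ring_hom_minus[OF assms(1-3)]
  show ?thesis
    by (rule R.two_sided_idealI)
      (auto simp: h R.mult_closed Q.two_sided_idealD[OF assms(4)])
qed

text \<open>If \<open>K\<close> is maximal among the ideals avoiding \<open>d\<close>, every nonzero ideal of the quotient by \<open>K\<close>
  pulls back to a strictly larger ideal and hence contains the image of \<open>d\<close>; so the intersection
  \<open>J\<close> of the nonzero ideals is nonzero.\<close>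

lemma exists_subdirectly_irreducible_quotient:
  fixes R :: "'a star_ring"
  assumes R: "star_regular u R" and d: "d \<in> carrier R" "d \<noteq> \<zero>\<^bsub>R\<^esub>"
  shows "\<exists>(Q :: 'a star_ring) J h. star_regular u Q \<and> minimal_ideal Q J \<and>
    h \<in> star_ring_hom u R Q \<and> h ` carrier R = carrier Q \<and> h d \<noteq> \<zero>\<^bsub>Q\<^esub>"
proof -
  interpret R: star_regular_ring u R using R by (simp add: star_regular_iff)
  obtain K where K: "two_sided_ideal K R" "d \<notin> K"
    and max: "\<And>L. two_sided_ideal L R \<Longrightarrow> d \<notin> L \<Longrightarrow> K \<subseteq> L \<Longrightarrow> L = K"
    using exists_maximal_ideal_avoiding[OF R.star_ring_axioms d] by blast
  obtain Q :: "'a star_ring" and h where Q: "star_regular u Q" "h \<in> star_ring_hom u R Q"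
    "h ` carrier R = carrier Q" and ker: "\<And>x. x \<in> carrier R \<Longrightarrow> h x = \<zero>\<^bsub>Q\<^esub> \<longleftrightarrow> x \<in> K"
    using R.exists_quotient[OF K(1)] by blast
  interpret Q: star_regular_ring u Q using Q(1) by (simp add: star_regular_iff)
  define J where "J = \<Inter>{L. two_sided_ideal L Q \<and> L \<noteq> {\<zero>\<^bsub>Q\<^esub>}}"
  have hd: "h d \<in> L" if L: "two_sided_ideal L Q" "L \<noteq> {\<zero>\<^bsub>Q\<^esub>}" for L
  proof (rule ccontr)
    assume "h d \<notin> L"
    note LD = Q.two_sided_idealD[OF L(1)]
    have "K \<subseteq> {x \<in> carrier R. h x \<in> L}"
    proof
      fix x assume "x \<in> K"
      then have "x \<in> carrier R" using R.two_sided_idealD(1)[OF K(1)] by blast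
      moreover have "h x = \<zero>\<^bsub>Q\<^esub>" using ker \<open>x \<in> K\<close> calculation by simp
      ultimately show "x \<in> {x \<in> carrier R. h x \<in> L}" using LD(2) by simp
    qed
    then have eq: "{x \<in> carrier R. h x \<in> L} = K"
      using max vimage_ideal[OF R.star_ring_axioms Q.star_ring_axioms Q(2) L(1)] \<open>h d \<notin> L\<close> by blast
    have "y = \<zero>\<^bsub>Q\<^esub>" if "y \<in> L" for y
    proof -
      have "y \<in> h ` carrier R" using that LD(1) Q(3) by auto
      then show ?thesis using eq ker that by auto
    qed
    then show False using L(2) LD(2) by blast
  qed
  have "two_sided_ideal (carrier Q) Q"
    by (rule Q.two_sided_idealI) (auto simp: Q.mult_closed)
  moreover have hd0: "h d \<noteq> \<zero>\<^bsub>Q\<^esub>" "h d \<in> carrier Q"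
    using ker[OF d(1)] K(2) Q(3) d(1) by auto
  ultimately have "J \<subseteq> carrier Q" unfolding J_def by blast
  then have "two_sided_ideal J Q"
    proof (rule Q.two_sided_idealI)
    show "\<zero>\<^bsub>Q\<^esub> \<in> J" by (simp add: J_def Q.two_sided_idealD)
  qed (unfold J_def, (blast dest: Q.two_sided_idealD)+)
  moreover have "h d \<in> J" using hd by (auto simp: J_def)
  ultimately have "minimal_ideal Q J"
    using hd0 by (auto simp: minimal_ideal_def J_def)
  then show ?thesis using Q hd0 by blast
qed

lemma varietyE:
  assumes "variety u V"
  obtains E where "\<And>s t. (s, t) \<in> E \<Longrightarrow> in_signature u s \<and> in_signature u t"
    and "\<And>A. A \<in> V \<longleftrightarrow> star_regular u A \<and> (\<forall>s t. (s, t) \<in> E \<longrightarrow> satisfies A s t)"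
proof -
  from assms obtain E where "\<forall>(s, t)\<in>E. in_signature u s \<and> in_signature u t"
    "V = {R. star_regular u R \<and> (\<forall>(s, t)\<in>E. satisfies R s t)}"
    unfolding variety_def by (elim exE conjE)
  then show thesis by (intro that[of E]) auto
qed

text \<open>A failing identity is pushed to a subdirectly irreducible quotient that separates its two
  sides, and fails in one of the simple corners there.\<close>

lemma satisfies_if_simple_members_satisfy:
  fixes R :: "'a star_ring"
  assumes V: "variety u V" "R \<in> V" and sig: "in_signature u s" "in_signature u t"
    and simple: "\<And>A. A \<in> V \<Longrightarrow> is_simple A \<Longrightarrow> satisfies A s t"
  shows "satisfies R s t"
  unfolding satisfies_def
proof (intro allI impI, rule ccontr)
  fix v :: "nat \<Rightarrow> 'a" assume v: "\<forall>n. v n \<in> carrier R" and ne: "interp R v s \<noteq> interp R v t"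
  obtain E where E: "\<And>s t. (s, t) \<in> E \<Longrightarrow> in_signature u s \<and> in_signature u t"
    and VE: "\<And>A. A \<in> V \<longleftrightarrow> star_regular u A \<and> (\<forall>s t. (s, t) \<in> E \<longrightarrow> satisfies A s t)"
    using varietyE[OF V(1)] by metis
  have R: "star_regular u R" using V(2) VE by blast
  interpret R: star_regular_ring u R using R by (simp add: star_regular_iff)
  have cl: "interp R v s \<in> carrier R" "interp R v t \<in> carrier R"
    using interp_closed[OF R] sig v by auto
  let ?d = "interp R v s \<ominus>\<^bsub>R\<^esub> interp R v t"
  obtain Q :: "'a star_ring" and J h where Q: "star_regular u Q" "minimal_ideal Q J"
    "h \<in> star_ring_hom u R Q" "h ` carrier R = carrier Q" "h ?d \<noteq> \<zero>\<^bsub>Q\<^esub>"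
    using exists_subdirectly_irreducible_quotient[OF R R.minus_closed[OF cl]] ne
      R.minus_zero_iff[OF cl] by blast
  interpret Q: subdirectly_irreducible_ring u Q J
    using Q(1,2) by (simp add: star_regular_iff subdirectly_irreducible_ring_def
      subdirectly_irreducible_ring_axioms_def)
  have QV: "satisfies Q s' t'" if "(s', t') \<in> E" for s' t'
  proof (rule satisfies_image[OF R Q(1,3,4)])
    show "in_signature u s'" "in_signature u t'" using E[OF that] by simp_all
    show "satisfies R s' t'" using V(2) VE that by simp
  qed
  have "satisfies (corner Q e) s t" if "e \<in> Q.nonzero_projections" for e
  proof (rule simple)
    have e: "is_projection Q e" "e \<in> J" "e \<noteq> \<zero>\<^bsub>Q\<^esub>"
      using that by (auto simp: Q.nonzero_projections_def)
    show "corner Q e \<in> V"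
      unfolding VE using Q.star_regular_corner[OF e(1)] Q.satisfies_corner[OF e(1)] QV E by simp
    show "is_simple (corner Q e)" using Q.corner_simple[OF e] .
  qed
  then have "satisfies Q s t" by (rule Q.satisfies_if_corners_satisfy[OF sig])
  then have "interp Q (\<lambda>n. h (v n)) s = interp Q (\<lambda>n. h (v n)) t"
    using v star_ring_homD(1)[OF Q(3)] by (simp add: satisfies_def)
  then have eq: "h (interp R v s) = h (interp R v t)"
    using interp_hom[OF R Q(1,3) sig(1)] interp_hom[OF R Q(1,3) sig(2)] v by simp
  have "h ?d = h (interp R v s) \<oplus>\<^bsub>Q\<^esub> \<ominus>\<^bsub>Q\<^esub> h (interp R v t)"
    using star_ring_homD(3)[OF Q(3)] cl
      star_ring_hom_minus[OF R.star_ring_axioms Q.star_ring_axioms Q(3)]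
    by (simp add: a_minus_def)
  then show False using Q(5) eq cl star_ring_homD(1)[OF Q(3)] by (simp add: Q.r_neg)
qed

theorem theorem3:
  fixes u :: bool
  shows
    "(\<forall>(R :: 'a star_ring) J.
        star_regular u R \<and> subdirectly_irreducible R \<and> minimal_ideal R J \<longrightarrow>
        (\<exists>(I :: 'a set) (e :: 'a \<Rightarrow> 'a) U S h.
           (\<forall>i \<in> I. is_projection R (e i) \<and> e i \<in> J \<and> e i \<noteq> \<zero>\<^bsub>R\<^esub>) \<and>
           ultrafilter_on I U \<and>
           star_subring u S (ultraproduct I (\<lambda>i. corner R (e i)) U) \<and>
           star_regular u ((ultraproduct I (\<lambda>i. corner R (e i)) U)\<lparr>carrier := S\<rparr>) \<and>
           h \<in> star_ring_hom u ((ultraproduct I (\<lambda>i. corner R (e i)) U)\<lparr>carrier := S\<rparr>) R \<and>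
           h ` S = carrier R)) \<and>
     (\<forall>V :: 'a star_ring set.
        variety u V \<longrightarrow> V = generated_variety u {R \<in> V. is_simple R})"
proof (intro conjI allI impI, goal_cases)
  case (1 R J)
  then interpret subdirectly_irreducible_ring u R J
    by (simp add: star_regular_iff subdirectly_irreducible_ring_def
      subdirectly_irreducible_ring_axioms_def)
  show ?case
    using image_of_ultraproduct_subring
    by (intro exI[of _ nonzero_projections] exI[of _ "\<lambda>e. e"])
      (simp add: nonzero_projections_def)
next
  case (2 V)
  have "R \<in> W" if "R \<in> V" and W: "variety u W" "{R \<in> V. is_simple R} \<subseteq> W" for R W
  proof -
    obtain E where E: "\<And>s t. (s, t) \<in> E \<Longrightarrow> in_signature u s \<and> in_signature u t"
      and WE: "\<And>A. A \<in> W \<longleftrightarrow> star_regular u A \<and> (\<forall>s t. (s, t) \<in> E \<longrightarrow> satisfies A s t)"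
      using varietyE[OF W(1)] by metis
    have "satisfies R s t" if "(s, t) \<in> E" for s t
    proof (rule satisfies_if_simple_members_satisfy[OF 2 \<open>R \<in> V\<close>])
      show "in_signature u s" "in_signature u t" using E[OF that] by simp_all
      show "satisfies A s t" if "A \<in> V" "is_simple A" for A
        using W(2) WE \<open>(s, t) \<in> E\<close> that by blast
    qed
    moreover have "star_regular u R" using varietyE[OF 2] \<open>R \<in> V\<close> by metis
    ultimately show ?thesis unfolding WE by blast
  qed
  then show ?case using 2 by (auto simp: generated_variety_def)
qed

end
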